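(* For each $n\ge 1$ let $X=X^{(n)}=(X_{ij})_{1\le i,j\le n}$ be a uniformly distributed $n\times n$ doubly stochastic matrix. Then, as $n\to\infty$, the law of $nX_{11}$ converges in total variation distance to the exponential distribution with mean $1$. Further, for every $\epsilon>0$, \[ d_{\mathrm{tv}}\bigl(nX_{11},\exp(1)\bigr)=O\bigl(n^{-1/2+\epsilon}\bigr)\quad\text{as } n\to\infty . \]
   Context: A doubly stochastic matrix is an $n\times n$ matrix with nonnegative real entries all of whose row sums and column sums equal $1$; the set of these, the Birkhoff polytope, is an $(n-1)^2$-dimensional polytope. "Uniformly distributed" means distributed according to normalized $(n-1)^2$-dimensional Lebesgue measure on this polytope; equivalently, the entries $(X_{ij})_{1\le i,j\le n-1}$ are uniform (normalized Lebesgue measure on $\mathbb{R}^{(n-1)^2}$) on the set of $(n-1)\times(n-1)$ matrices that are the upper-left block of some doubly stochastic $n\times n$ matrix. $\exp(1)$ denotes the exponential distribution with mean $1$, and $d_{\mathrm{tv}}$ denotes total variation distance between laws, $d_{\mathrm{tv}}(\mu,\nu)=\sup_A|\mu(A)-\nu(A)|$ over measurable sets $A$ (random variables are identified with their laws). *)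

theory Defs
  imports "HOL-Probability.Probability" "HOL-Library.Landau_Symbols"
begin

text \<open>
  Since the size of the matrices varies, an \<open>n \<times> n\<close> matrix is a function on index pairs
  that is \<^term>\<open>undefined\<close> outside \<open>{1..n} \<times> {1..n}\<close>.
\<close>

definition birkhoff_polytope :: "nat \<Rightarrow> (nat \<times> nat \<Rightarrow> real) set" where
  "birkhoff_polytope n =
     {x \<in> {1..n} \<times> {1..n} \<rightarrow>\<^sub>E {0..}.
        (\<forall>i\<in>{1..n}. (\<Sum>j\<in>{1..n}. x (i, j)) = 1) \<and>
        (\<forall>j\<in>{1..n}. (\<Sum>i\<in>{1..n}. x (i, j)) = 1)}"

definition upper_left_block :: "nat \<Rightarrow> (nat \<times> nat \<Rightarrow> real) \<Rightarrow> (nat \<times> nat \<Rightarrow> real)" where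
  "upper_left_block n x = restrict x ({1..n - 1} \<times> {1..n - 1})"

definition block_lebesgue :: "nat \<Rightarrow> (nat \<times> nat \<Rightarrow> real) measure" where
  "block_lebesgue n = (\<Pi>\<^sub>M ij\<in>{1..n - 1} \<times> {1..n - 1}. lborel)"

text \<open>
  The polytope is a null set for the \<open>n\<^sup>2\<close>-dimensional Lebesgue measure. A doubly stochastic
  matrix is determined affinely by its upper left \<open>(n - 1) \<times> (n - 1)\<close> block, so uniformity with
  respect to \<open>(n - 1)\<^sup>2\<close>-dimensional Lebesgue measure on the polytope is uniformity of that block.
  For \<open>n = 1\<close> the block is empty, \<^term>\<open>block_lebesgue 1\<close> is a point mass, and the matrix is
  almost surely the \<open>1 \<times> 1\<close> matrix with entry 1.
\<close>

definition uniform_doubly_stochastic ::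
    "nat \<Rightarrow> 'a measure \<Rightarrow> ('a \<Rightarrow> nat \<times> nat \<Rightarrow> real) \<Rightarrow> bool" where
  "uniform_doubly_stochastic n M X \<longleftrightarrow>
     prob_space M \<and>
     X \<in> M \<rightarrow>\<^sub>M (\<Pi>\<^sub>M ij\<in>{1..n} \<times> {1..n}. borel) \<and>
     (AE \<omega> in M. X \<omega> \<in> birkhoff_polytope n) \<and>
     distr M (block_lebesgue n) (\<lambda>\<omega>. upper_left_block n (X \<omega>)) =
       uniform_measure (block_lebesgue n) (upper_left_block n ` birkhoff_polytope n)"

text \<open>Intended for probability measures on the same sigma-algebra.\<close>

definition tv_dist :: "'a measure \<Rightarrow> 'a measure \<Rightarrow> real" where
  "tv_dist \<mu> \<nu> = (SUP A\<in>sets \<mu>. \<bar>measure \<mu> A - measure \<nu> A\<bar>)"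

end

theory Submission
  imports Defs "HOL-Real_Asymp.Real_Asymp"
begin

text \<open>
  The uniform law on the block set has entropy \<open>ln V\<close>, where \<open>V\<close> is its volume, and by subadditivity this
  is at most the sum of the \<open>(n - 1)\<^sup>2\<close> equal entropies of the entries. The exponential law maximises the
  entropy for a given mean, so a lower bound \<open>V \<ge> (e / n) ^ (n - 1)\<^sup>2 * exp (- C n ln n)\<close> leaves a relative
  entropy \<open>O(ln n / n)\<close> per entry, hence a total variation distance \<open>O(sqrt (ln n / n))\<close>. The entropy
  argument is carried out in its dual form, by integrating a product of exponentially tilted
  exponential densities over the block set.

  The volume bound is obtained by filling the matrix row by row. If \<open>k + 1\<close> rows remain and the columns
  have remaining mass \<open>\<rho>\<^sub>j\<close>, of total \<open>k + 1\<close>, the volume of the completions is at least a constant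
  times \<open>\<Prod>\<^sub>j \<rho>\<^sub>j ^ k\<close>: adding a row turns this product into a convolution of \<open>n\<close> truncated powers
  evaluated at its mean, and a log-concave density of bounded height and support cannot be
  smaller than a power of \<open>n\<close> at its mean.
\<close>

section \<open>Log-concave functions and convolution\<close>

text \<open>Total positivity of order 2 of the kernel \<open>f (x - y)\<close>, the four-point form
  of log-concavity. It needs no logarithms, so zeros are allowed, and convolution preserves it by
  rearrangement.\<close>

definition log_concave :: "(real \<Rightarrow> ennreal) \<Rightarrow> bool" where
  "log_concave f \<longleftrightarrow> (\<forall>x u v. 0 \<le> u \<longrightarrow> 0 \<le> v \<longrightarrow> f x * f (x + u + v) \<le> f (x + u) * f (x + v))"

lemma log_concaveD:
  assumes "log_concave f" "a \<le> b" "a \<le> c" "a + d = b + c"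
  shows "f a * f d \<le> f b * f c"
proof -
  have "f a * f (a + (b - a) + (c - a)) \<le> f (a + (b - a)) * f (a + (c - a))"
    using assms unfolding log_concave_def by (metis diff_ge_0_iff_ge)
  moreover have "a + (b - a) + (c - a) = d" using assms by simp
  ultimately show ?thesis by simp
qed

definition convolution_fun :: "(real \<Rightarrow> ennreal) \<Rightarrow> (real \<Rightarrow> ennreal) \<Rightarrow> real \<Rightarrow> ennreal" where
  "convolution_fun f g x = (\<integral>\<^sup>+t. f t * g (x - t) \<partial>lborel)"

text \<open>This is \<open>(b - a) * (d - c) \<ge> 0\<close> multiplied out. The differences become
  witnesses \<open>p\<close> and \<open>q\<close>, because subtraction in \<open>ennreal\<close>
  does not cancel at infinity.\<close>

lemma ennreal_rearrangement:
  fixes a b c d :: ennreal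
  assumes "a \<le> b" "c \<le> d"
  shows "a * d + b * c \<le> a * c + b * d"
proof -
  obtain p q where "b = a + p" "d = c + q" using assms by (auto simp: le_iff_add)
  then show ?thesis by (simp add: algebra_simps)
qed

lemma nn_integral_shift:
  fixes f :: "real \<Rightarrow> ennreal"
  assumes [measurable]: "f \<in> borel_measurable borel"
  shows "(\<integral>\<^sup>+t. f (t - a) \<partial>lborel) = (\<integral>\<^sup>+t. f t \<partial>lborel)"
  using nn_integral_real_affine[of f 1 "-a"] by (simp add: algebra_simps)

text \<open>Moving the shift \<open>y\<close> onto the first factor leaves \<open>g\<close> with the
  argument \<open>x - t\<close>; the two products compared in the next lemma then differ in
  \<open>f\<close> alone.\<close>

lemma convolution_fun_shift:
  assumes [measurable]: "f \<in> borel_measurable borel" "g \<in> borel_measurable borel"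
  shows "convolution_fun f g (x - y) = (\<integral>\<^sup>+t. f (t - y) * g (x - t) \<partial>lborel)"
proof -
  have "(\<integral>\<^sup>+t. (\<lambda>t. f t * g (x - y - t)) (t - y) \<partial>lborel) = (\<integral>\<^sup>+t. f t * g (x - y - t) \<partial>lborel)"
    by (rule nn_integral_shift) simp
  then show ?thesis by (simp add: convolution_fun_def)
qed

text \<open>The order-2 case of the composition formula for totally positive kernels. Both products
  are double integrals with the common factor \<open>g (x1 - t) * g (x2 - s)\<close>. After
  symmetrisation their difference is, up to a factor 2, the integral of a product of two 2x2 minors,
  one in \<open>f\<close> and one in \<open>g\<close>, of the same sign.\<close>

lemma log_concave_convolution_fun:
  assumes [measurable]: "f \<in> borel_measurable borel" "g \<in> borel_measurable borel"
    and f: "log_concave f" and g: "log_concave g"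
  shows "log_concave (convolution_fun f g)"
  unfolding log_concave_def
proof (intro allI impI)
  fix x u v :: real
  assume "0 \<le> u" "0 \<le> v"
  let ?h = "convolution_fun f g"
  define x1 x2 where "x1 = x + u" and "x2 = x + u + v"
  have x12: "x1 \<le> x2" using \<open>0 \<le> v\<close> by (simp add: x1_def x2_def)
  have P: "?h x * ?h (x + u + v) = (\<integral>\<^sup>+t. \<integral>\<^sup>+s. f (t - u) * g (x1 - t) * (f s * g (x2 - s)) \<partial>lborel \<partial>lborel)"
    using convolution_fun_shift[of f g x1 u] convolution_fun_shift[of f g x2 0]
    by (simp add: x1_def x2_def nn_integral_cmult nn_integral_multc)
  have Q: "?h (x + u) * ?h (x + v) = (\<integral>\<^sup>+t. \<integral>\<^sup>+s. f t * g (x1 - t) * (f (s - u) * g (x2 - s)) \<partial>lborel \<partial>lborel)"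
  proof -
    have "x2 - u = x + v" by (simp add: x2_def)
    then have "?h (x + u) * ?h (x + v) = (\<integral>\<^sup>+t. f t * g (x1 - t) \<partial>lborel) * (\<integral>\<^sup>+s. f (s - u) * g (x2 - s) \<partial>lborel)"
      using convolution_fun_shift[of f g x1 0] convolution_fun_shift[of f g x2 u] by (simp add: x1_def)
    then show ?thesis by (simp add: nn_integral_cmult nn_integral_multc)
  qed
  define p where "p t s = f (t - u) * g (x1 - t) * (f s * g (x2 - s))" for t s
  define q where "q t s = f t * g (x1 - t) * (f (s - u) * g (x2 - s))" for t s
  have [measurable]: "case_prod p \<in> borel_measurable (lborel \<Otimes>\<^sub>M lborel)"
      "case_prod q \<in> borel_measurable (lborel \<Otimes>\<^sub>M lborel)"
    unfolding p_def q_def by measurable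
  \<comment> \<open>The inequality between \<open>p\<close> and \<open>q\<close> holds only after symmetrisation in \<open>(t, s)\<close>.\<close>
  have sym: "(\<integral>\<^sup>+t. \<integral>\<^sup>+s. (r t s + r s t) \<partial>lborel \<partial>lborel) = 2 * (\<integral>\<^sup>+t. \<integral>\<^sup>+s. r t s \<partial>lborel \<partial>lborel)"
    if [measurable]: "case_prod r \<in> borel_measurable (lborel \<Otimes>\<^sub>M lborel)" for r :: "real \<Rightarrow> real \<Rightarrow> ennreal"
  proof -
    have "(\<integral>\<^sup>+t. \<integral>\<^sup>+s. (r t s + r s t) \<partial>lborel \<partial>lborel)
        = (\<integral>\<^sup>+t. \<integral>\<^sup>+s. r t s \<partial>lborel \<partial>lborel) + (\<integral>\<^sup>+t. \<integral>\<^sup>+s. r s t \<partial>lborel \<partial>lborel)"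
      by (simp add: nn_integral_add)
    also have "(\<integral>\<^sup>+t. \<integral>\<^sup>+s. r s t \<partial>lborel \<partial>lborel) = (\<integral>\<^sup>+t. \<integral>\<^sup>+s. r t s \<partial>lborel \<partial>lborel)"
      using lborel_pair.Fubini'[of r] by simp
    finally show ?thesis by (simp add: mult_2)
  qed
  have le: "p t s + p s t \<le> q t s + q s t" if "t \<le> s" for t s
  proof -
    have "f (t - u) * f s \<le> f t * f (s - u)"
      by (rule log_concaveD[OF f]) (use that \<open>0 \<le> u\<close> in auto)
    moreover have "g (x1 - s) * g (x2 - t) \<le> g (x1 - t) * g (x2 - s)"
      by (rule log_concaveD[OF g]) (use that x12 in auto)
    ultimately have "f (t - u) * f s * (g (x1 - t) * g (x2 - s)) + f t * f (s - u) * (g (x1 - s) * g (x2 - t))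
       \<le> f (t - u) * f s * (g (x1 - s) * g (x2 - t)) + f t * f (s - u) * (g (x1 - t) * g (x2 - s))"
      by (rule ennreal_rearrangement)
    then show ?thesis by (simp add: p_def q_def mult_ac add_ac)
  qed
  have "p t s + p s t \<le> q t s + q s t" for t s
    using le[of t s] le[of s t] by (cases "t \<le> s") (auto simp: add.commute)
  then have "(\<integral>\<^sup>+t. \<integral>\<^sup>+s. (p t s + p s t) \<partial>lborel \<partial>lborel) \<le> (\<integral>\<^sup>+t. \<integral>\<^sup>+s. (q t s + q s t) \<partial>lborel \<partial>lborel)"
    by (intro nn_integral_mono)
  then have "2 * (\<integral>\<^sup>+t. \<integral>\<^sup>+s. p t s \<partial>lborel \<partial>lborel) \<le> 2 * (\<integral>\<^sup>+t. \<integral>\<^sup>+s. q t s \<partial>lborel \<partial>lborel)"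
    by (simp add: sym)
  then have "(\<integral>\<^sup>+t. \<integral>\<^sup>+s. p t s \<partial>lborel \<partial>lborel) \<le> (\<integral>\<^sup>+t. \<integral>\<^sup>+s. q t s \<partial>lborel \<partial>lborel)"
    by (subst (asm) ennreal_mult_le_mult_iff) auto
  then show "?h x * ?h (x + u + v) \<le> ?h (x + u) * ?h (x + v)"
    by (simp add: P Q p_def q_def)
qed

section \<open>Profiles: mass, mean, support and height under convolution\<close>

text \<open>
  \<open>i\<close> is the mass, \<open>m\<close> the mean and \<open>R\<close> the right end of the support; \<open>B\<close> collects upper bounds for the
  density after normalisation, each of which survives convolution with any other profile.
\<close>

definition profile :: "(real \<Rightarrow> ennreal) \<Rightarrow> real \<Rightarrow> real \<Rightarrow> real \<Rightarrow> real set \<Rightarrow> bool" where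
  "profile f R i m B \<longleftrightarrow> f \<in> borel_measurable borel \<and> 0 \<le> i \<and> 0 \<le> m \<and>
     (\<forall>x. x < 0 \<or> R < x \<longrightarrow> f x = 0) \<and>
     (\<integral>\<^sup>+x. f x \<partial>lborel) = ennreal i \<and>
     (\<integral>\<^sup>+x. ennreal x * f x \<partial>lborel) = ennreal (m * i) \<and>
     (\<forall>b\<in>B. 0 \<le> b \<and> (\<forall>x. f x \<le> ennreal (b * i))) \<and> log_concave f"

lemma profile_convolution_fun:
  assumes f: "profile f R i m B" and g: "profile g S j l C"
  shows "profile (convolution_fun f g) (R + S) (i * j) (m + l) (B \<union> C)"
proof -
  have [measurable]: "f \<in> borel_measurable borel" "g \<in> borel_measurable borel"
    using f g by (auto simp: profile_def)
  have nn: "0 \<le> i" "0 \<le> j" "0 \<le> m" "0 \<le> l" using f g by (auto simp: profile_def)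
  have If: "(\<integral>\<^sup>+x. f x \<partial>lborel) = ennreal i" and Ig: "(\<integral>\<^sup>+x. g x \<partial>lborel) = ennreal j"
    and Mf: "(\<integral>\<^sup>+x. ennreal x * f x \<partial>lborel) = ennreal (m * i)"
    and Mg: "(\<integral>\<^sup>+x. ennreal x * g x \<partial>lborel) = ennreal (l * j)"
    and zf: "\<And>x. x < 0 \<or> R < x \<Longrightarrow> f x = 0" and zg: "\<And>x. x < 0 \<or> S < x \<Longrightarrow> g x = 0"
    using f g by (auto simp: profile_def)
  have meas: "convolution_fun f g \<in> borel_measurable borel"
    unfolding convolution_fun_def by measurable
  have supp: "convolution_fun f g x = 0" if "x < 0 \<or> R + S < x" for x
  proof -
    have "f t * g (x - t) = 0" for t
    proof (cases "t < 0 \<or> R < t")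
      case False
      then have "x - t < 0 \<or> S < x - t" using that by auto
      then show ?thesis using zg by simp
    qed (use zf in simp)
    then have "(\<lambda>t. f t * g (x - t)) = (\<lambda>_. 0)" by (rule ext)
    then show ?thesis by (simp add: convolution_fun_def)
  qed
  have mass: "(\<integral>\<^sup>+x. convolution_fun f g x \<partial>lborel) = ennreal (i * j)"
  proof -
    have "(\<integral>\<^sup>+x. convolution_fun f g x \<partial>lborel) = (\<integral>\<^sup>+t. \<integral>\<^sup>+x. f t * g (x - t) \<partial>lborel \<partial>lborel)"
      unfolding convolution_fun_def by (rule lborel_pair.Fubini') measurable
    also have "\<dots> = (\<integral>\<^sup>+t. f t * ennreal j \<partial>lborel)"
      by (simp add: nn_integral_cmult nn_integral_shift Ig)
    finally show ?thesis by (simp add: nn_integral_multc If ennreal_mult nn)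
  qed
  have mean: "(\<integral>\<^sup>+x. ennreal x * convolution_fun f g x \<partial>lborel) = ennreal ((m + l) * (i * j))"
  proof -
    \<comment> \<open>First moments split along \<open>x = t + (x - t)\<close>. As
      \<open>ennreal\<close> sends negative reals to 0, this needs \<open>t\<close> and
      \<open>x - t\<close> to be nonnegative; otherwise \<open>f t\<close> or
      \<open>g (x - t)\<close> vanishes.\<close>
    have eq: "ennreal x * (f t * g (x - t)) = ennreal t * f t * g (x - t) + f t * (ennreal (x - t) * g (x - t))" for x t
    proof (cases "t < 0 \<or> x - t < 0")
      case True
      then show ?thesis using zf zg by auto
    next
      case False
      then have "ennreal x = ennreal t + ennreal (x - t)" by (simp flip: ennreal_plus)
      then show ?thesis by (simp add: algebra_simps)
    qed
    have "(\<integral>\<^sup>+x. ennreal x * convolution_fun f g x \<partial>lborel) = (\<integral>\<^sup>+x. \<integral>\<^sup>+t. ennreal x * (f t * g (x - t)) \<partial>lborel \<partial>lborel)"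
      unfolding convolution_fun_def by (simp add: nn_integral_cmult)
    also have "\<dots> = (\<integral>\<^sup>+t. \<integral>\<^sup>+x. ennreal x * (f t * g (x - t)) \<partial>lborel \<partial>lborel)"
      by (rule lborel_pair.Fubini') measurable
    also have "\<dots> = (\<integral>\<^sup>+t. ennreal t * f t * ennreal j + f t * ennreal (l * j) \<partial>lborel)"
    proof (rule nn_integral_cong)
      fix t
      show "(\<integral>\<^sup>+x. ennreal x * (f t * g (x - t)) \<partial>lborel) = ennreal t * f t * ennreal j + f t * ennreal (l * j)"
        using nn_integral_shift[of g t] nn_integral_shift[of "\<lambda>x. ennreal x * g x" t]
        by (simp add: eq nn_integral_add nn_integral_cmult Ig Mg)
    qed
    also have "\<dots> = ennreal (m * i) * ennreal j + ennreal i * ennreal (l * j)"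
      by (simp add: nn_integral_add nn_integral_multc If Mf)
    also have "\<dots> = ennreal ((m + l) * (i * j))"
      using nn by (simp add: algebra_simps flip: ennreal_mult ennreal_plus)
    finally show ?thesis .
  qed
  \<comment> \<open>A convolution is bounded by the height of one factor times the mass of the
    other, so a height bound of either factor can be kept.\<close>
  have bound: "0 \<le> b \<and> (\<forall>x. convolution_fun f g x \<le> ennreal (b * (i * j)))" if "b \<in> B \<union> C" for b
  proof
    show "0 \<le> b" using that f g by (auto simp: profile_def)
    show "\<forall>x. convolution_fun f g x \<le> ennreal (b * (i * j))"
    proof
      fix x
      from that show "convolution_fun f g x \<le> ennreal (b * (i * j))"
      proof
        assume "b \<in> C"
        then have b: "0 \<le> b" "\<And>x. g x \<le> ennreal (b * j)" using g by (auto simp: profile_def)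
        have "convolution_fun f g x \<le> (\<integral>\<^sup>+t. f t * ennreal (b * j) \<partial>lborel)"
          unfolding convolution_fun_def by (intro nn_integral_mono mult_left_mono b) auto
        also have "\<dots> = ennreal (b * (i * j))"
          using nn b by (simp add: nn_integral_multc If mult_ac flip: ennreal_mult)
        finally show ?thesis .
      next
        assume "b \<in> B"
        then have b: "0 \<le> b" "\<And>x. f x \<le> ennreal (b * i)" using f by (auto simp: profile_def)
        have "convolution_fun f g x \<le> (\<integral>\<^sup>+t. ennreal (b * i) * g (x - t) \<partial>lborel)"
          unfolding convolution_fun_def by (intro nn_integral_mono mult_right_mono b) auto
        also have "\<dots> = ennreal (b * i) * ennreal j"
          using nn_integral_real_affine[of g "-1" x] by (simp add: nn_integral_cmult Ig)
        also have "\<dots> = ennreal (b * (i * j))"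
          using nn b by (simp add: mult_ac flip: ennreal_mult)
        finally show ?thesis .
      qed
    qed
  qed
  have "log_concave f" "log_concave g" using f g by (auto simp: profile_def)
  then have "log_concave (convolution_fun f g)" by (intro log_concave_convolution_fun) simp_all
  then show ?thesis unfolding profile_def using meas supp mass mean bound nn by auto
qed

text \<open>The one-sided first moments about the mean agree. The height bound leaves at least half
  of the mass at distance at least \<open>1 / (4 * b)\<close> from 1, so each moment is at least
  \<open>i / (16 * b)\<close>. For \<open>a \<le> 1 \<le> x\<close> log-concavity gives \<open>f a *
  f x \<le> f 1 * f (a + x - 1) \<le> f 1 * ennreal (b * i)\<close>, and integration bounds the
  product of the moments by \<open>f 1 * (b * i) * R ^ 2\<close>. Here 256 is the square of
  16.\<close>

lemma profile_at_mean:
  assumes f: "profile f R i 1 B" and "0 < i" "b \<in> B" "0 < b" "1 \<le> R"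
  shows "f 1 \<ge> ennreal (i / (256 * b ^ 3 * R ^ 2))"
proof -
  have [measurable]: "f \<in> borel_measurable borel"
    using f by (auto simp: profile_def)
  have If: "(\<integral>\<^sup>+x. f x \<partial>lborel) = ennreal i"
    and Mf: "(\<integral>\<^sup>+x. ennreal x * f x \<partial>lborel) = ennreal i"
    and zf: "\<And>x. x < 0 \<or> R < x \<Longrightarrow> f x = 0"
    and fb: "\<And>x. f x \<le> ennreal (b * i)" and lc: "log_concave f"
    using f \<open>b \<in> B\<close> by (auto simp: profile_def)
  \<comment> \<open>Conversion to \<open>ennreal\<close> takes positive parts, so \<open>N\<close>
    and \<open>P\<close> are the moments to the left and to the right of 1.\<close>
  define N where "N = (\<integral>\<^sup>+x. ennreal (1 - x) * f x \<partial>lborel)"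
  define P where "P = (\<integral>\<^sup>+x. ennreal (x - 1) * f x \<partial>lborel)"
  have "ennreal (x - 1) * f x + f x = ennreal x * f x + ennreal (1 - x) * f x" for x
  proof (cases "x < 0")
    case False
    then have "ennreal (x - 1) + 1 = ennreal x + ennreal (1 - x)"
      by (cases "x \<le> 1") (auto simp: ennreal_neg simp flip: ennreal_plus ennreal_1)
    then show ?thesis by (metis distrib_right mult_1)
  qed (use zf in simp)
  then have "(\<integral>\<^sup>+x. ennreal (x - 1) * f x + f x \<partial>lborel) = (\<integral>\<^sup>+x. ennreal x * f x + ennreal (1 - x) * f x \<partial>lborel)"
    by simp
  then have "P + ennreal i = ennreal i + N"
    by (simp add: nn_integral_add If Mf P_def N_def)
  then have PN: "P = N" by (simp add: add.commute ennreal_add_left_cancel)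
  have "N \<le> (\<integral>\<^sup>+x. f x \<partial>lborel)"
    unfolding N_def
  proof (rule nn_integral_mono)
    fix x
    show "ennreal (1 - x) * f x \<le> f x"
    proof (cases "x < 0")
      case False
      then have "ennreal (1 - x) * f x \<le> 1 * f x" by (intro mult_right_mono) auto
      then show ?thesis by simp
    qed (use zf in simp)
  qed
  then have "N \<noteq> \<infinity>" using If by (auto simp: top_unique)
  then obtain v where v: "N = ennreal v" "0 \<le> v" by (cases N) auto
  \<comment> \<open>With this \<open>d\<close> the interval of length \<open>2 * d\<close> around 1
    carries at most half of the mass.\<close>
  define d where "d = 1 / (4 * b)"
  have "0 < d" using \<open>0 < b\<close> by (simp add: d_def)
  have "ennreal d * ennreal i = (\<integral>\<^sup>+x. ennreal d * f x \<partial>lborel)"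
    by (simp add: nn_integral_cmult If)
  also have "\<dots> \<le> (\<integral>\<^sup>+x. ennreal (1 - x) * f x + ennreal (x - 1) * f x + ennreal (d * (b * i)) * indicator {1-d..1+d} x \<partial>lborel)"
  proof (rule nn_integral_mono)
    fix x
    show "ennreal d * f x \<le> ennreal (1 - x) * f x + ennreal (x - 1) * f x + ennreal (d * (b * i)) * indicator {1-d..1+d} x"
    proof (cases "x \<in> {1-d..1+d}")
      case True
      have "ennreal d * f x \<le> ennreal d * ennreal (b * i)" by (intro mult_left_mono fb) auto
      also have "\<dots> = ennreal (d * (b * i))" using \<open>0 < d\<close> by (simp add: ennreal_mult')
      finally show ?thesis using True by (simp add: add_increasing)
    next
      case False
      then have "ennreal d \<le> ennreal (1 - x) + ennreal (x - 1)"
        using \<open>0 < d\<close> by (cases "x \<le> 1") (auto simp: ennreal_neg)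
      then have "ennreal d * f x \<le> (ennreal (1 - x) + ennreal (x - 1)) * f x" by (rule mult_right_mono) simp
      then show ?thesis using False by (simp add: distrib_right)
    qed
  qed
  also have "\<dots> = N + P + ennreal (d * (b * i)) * ennreal (2 * d)"
    using \<open>0 < d\<close> by (simp add: nn_integral_add nn_integral_cmult N_def P_def)
  finally have "ennreal (d * i) \<le> ennreal (v + v + d * (b * i) * (2 * d))"
    using v PN \<open>0 < d\<close> \<open>0 < i\<close> \<open>0 < b\<close> by (simp flip: ennreal_mult ennreal_plus)
  then have "d * i \<le> v + v + d * (b * i) * (2 * d)"
    using v \<open>0 < d\<close> \<open>0 < i\<close> \<open>0 < b\<close> by (subst (asm) ennreal_le_iff) auto
  then have v_ge: "i / (16 * b) \<le> v" using \<open>0 < b\<close> by (simp add: d_def field_simps)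
  have upper: "ennreal (x - 1) * f x * N \<le> f 1 * ennreal (b * i) * ennreal R * indicator {1..R} x" for x
  proof (cases "x \<in> {1..R}")
    case True
    have "f x * N = (\<integral>\<^sup>+a. f x * (ennreal (1 - a) * f a) \<partial>lborel)"
      by (simp add: N_def nn_integral_cmult)
    also have "\<dots> \<le> (\<integral>\<^sup>+a. f 1 * ennreal (b * i) * indicator {0..1::real} a \<partial>lborel)"
    proof (rule nn_integral_mono)
      fix a
      show "f x * (ennreal (1 - a) * f a) \<le> f 1 * ennreal (b * i) * indicator {0..1} a"
      proof (cases "a \<in> {0..1}")
        case a: True
        have "f a * f x \<le> f 1 * f (a + x - 1)" by (rule log_concaveD[OF lc]) (use a True in auto)
        also have "\<dots> \<le> f 1 * ennreal (b * i)" by (intro mult_left_mono fb) auto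
        finally have "f a * f x \<le> f 1 * ennreal (b * i)" .
        moreover have "ennreal (1 - a) \<le> 1" using a by simp
        ultimately have "ennreal (1 - a) * (f a * f x) \<le> 1 * (f 1 * ennreal (b * i))"
          by (intro mult_mono[of "ennreal (1 - a)" 1]) auto
        then show ?thesis using a by (simp add: mult_ac)
      qed (use zf in \<open>auto simp: ennreal_neg\<close>)
    qed
    also have "\<dots> = f 1 * ennreal (b * i)" by (simp add: nn_integral_cmult)
    finally have "f x * N \<le> f 1 * ennreal (b * i)" .
    then have "ennreal (x - 1) * (f x * N) \<le> ennreal R * (f 1 * ennreal (b * i))"
      using True by (intro mult_mono[of "ennreal (x - 1)" "ennreal R"]) (auto intro: ennreal_leI)
    then show ?thesis using True by (simp add: mult_ac)
  qed (use zf in \<open>auto simp: ennreal_neg\<close>)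
  have "P * N = (\<integral>\<^sup>+x. ennreal (x - 1) * f x * N \<partial>lborel)"
    by (simp add: P_def nn_integral_multc)
  also have "\<dots> \<le> (\<integral>\<^sup>+x. f 1 * ennreal (b * i) * ennreal R * indicator {1..R} x \<partial>lborel)"
    by (intro nn_integral_mono upper)
  also have "\<dots> = f 1 * ennreal (b * i) * ennreal R * ennreal (R - 1)"
    using \<open>1 \<le> R\<close> by (simp add: nn_integral_cmult)
  also have "\<dots> \<le> f 1 * ennreal (b * i) * ennreal R * ennreal R"
    by (intro mult_left_mono ennreal_leI) auto
  finally have *: "ennreal (v * v) \<le> f 1 * ennreal (b * i) * ennreal R * ennreal R"
    using v PN by (simp add: ennreal_mult)
  obtain w where w: "f 1 = ennreal w" "0 \<le> w" using fb[of 1] by (cases "f 1") (auto simp: top_unique)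
  have "ennreal (v * v) \<le> ennreal (w * (b * i) * R * R)"
    using * w \<open>0 < i\<close> \<open>0 < b\<close> \<open>1 \<le> R\<close> by (simp add: ennreal_mult)
  then have "v * v \<le> w * (b * i) * R * R"
    using w \<open>0 < i\<close> \<open>0 < b\<close> \<open>1 \<le> R\<close> by (subst (asm) ennreal_le_iff) auto
  moreover have "i / (16 * b) * (i / (16 * b)) \<le> v * v"
    using v_ge v \<open>0 < i\<close> \<open>0 < b\<close> by (intro mult_mono) auto
  ultimately have "(i / (16 * b) * (i / (16 * b))) * (256 * (b * b)) \<le> (w * (b * i) * R * R) * (256 * (b * b))"
    by (intro mult_right_mono) auto
  moreover have "(i / (16 * b) * (i / (16 * b))) * (256 * (b * b)) = i * i"
    using \<open>0 < b\<close> by simp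
  moreover have "(w * (b * i) * R * R) * (256 * (b * b)) = i * (w * (256 * b ^ 3 * R ^ 2))"
    by (simp add: power2_eq_square power3_eq_cube)
  ultimately have "i \<le> w * (256 * b ^ 3 * R ^ 2)"
    using \<open>0 < i\<close> by (metis mult_le_cancel_left_pos)
  moreover have "0 < 256 * b ^ 3 * R ^ 2" using \<open>0 < b\<close> \<open>1 \<le> R\<close> by simp
  ultimately have "i / (256 * b ^ 3 * R ^ 2) \<le> w" by (simp only: pos_divide_le_eq)
  then show ?thesis using w by (simp add: ennreal_leI)
qed

section \<open>Truncated powers and their iterated convolutions\<close>

text \<open>The factor that a column of remaining mass \<open>r\<close> contributes to the volume
  bound after giving the entry \<open>x\<close> to a new row. The indicator keeps entry and
  remainder nonnegative.\<close>

definition trunc_power :: "nat \<Rightarrow> real \<Rightarrow> real \<Rightarrow> ennreal" where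
  "trunc_power p r x = ennreal ((r - x) ^ p) * indicator {0..r} x"

lemma log_concave_trunc_power: "log_concave (trunc_power p r)"
  unfolding log_concave_def
proof (intro allI impI)
  fix x u v :: real
  assume "0 \<le> u" "0 \<le> v"
  show "trunc_power p r x * trunc_power p r (x + u + v) \<le> trunc_power p r (x + u) * trunc_power p r (x + v)"
  proof (cases "x < 0 \<or> r < x + u + v")
    case True
    then show ?thesis by (auto simp: trunc_power_def)
  next
    case False
    have "(r - x) * (r - (x + u + v)) + u * v = (r - (x + u)) * (r - (x + v))" by (simp add: algebra_simps)
    then have "(r - x) * (r - (x + u + v)) \<le> (r - (x + u)) * (r - (x + v))"
      using \<open>0 \<le> u\<close> \<open>0 \<le> v\<close> by (smt (verit) mult_nonneg_nonneg)
    moreover have "0 \<le> (r - x) * (r - (x + u + v))" using False \<open>0 \<le> u\<close> \<open>0 \<le> v\<close> by simp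
    ultimately have "((r - x) * (r - (x + u + v))) ^ p \<le> ((r - (x + u)) * (r - (x + v))) ^ p"
      by (rule power_mono)
    then show ?thesis using False \<open>0 \<le> u\<close> \<open>0 \<le> v\<close>
      by (simp add: trunc_power_def power_mult_distrib ennreal_leI flip: ennreal_mult)
  qed
qed

lemma nn_integral_trunc_power:
  assumes "0 \<le> r"
  shows "(\<integral>\<^sup>+x. trunc_power p r x \<partial>lborel) = ennreal (r ^ Suc p / real (Suc p))"
proof -
  have "(\<integral>\<^sup>+x. ennreal ((r - x) ^ p) * indicator {0..r} x \<partial>lborel)
      = ennreal ((\<lambda>x. - ((r - x) ^ Suc p / real (Suc p))) r - (\<lambda>x. - ((r - x) ^ Suc p / real (Suc p))) 0)"
  proof (rule nn_integral_FTC_Icc)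
    show "((\<lambda>x. - ((r - x) ^ Suc p / real (Suc p))) has_real_derivative (r - x) ^ p) (at x)" for x
      by (auto intro!: derivative_eq_intros simp del: power_Suc of_nat_Suc)
  qed (use assms in auto)
  then show ?thesis by (simp add: trunc_power_def)
qed

lemma nn_integral_trunc_power_moment:
  assumes "0 \<le> r"
  shows "(\<integral>\<^sup>+x. ennreal x * trunc_power p r x \<partial>lborel)
    = ennreal (r / real (p + 2) * (r ^ Suc p / real (Suc p)))"
proof -
  \<comment> \<open>An antiderivative found by writing \<open>x * (r - x) ^ p\<close> as
    \<open>r * (r - x) ^ p - (r - x) ^ Suc p\<close>.\<close>
  define F where "F x = (r - x) ^ Suc (Suc p) / real (Suc (Suc p)) - r * ((r - x) ^ Suc p / real (Suc p))" for x
  have "(\<integral>\<^sup>+x. ennreal (x * (r - x) ^ p) * indicator {0..r} x \<partial>lborel) = ennreal (F r - F 0)"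
  proof (rule nn_integral_FTC_Icc)
    show "(F has_real_derivative x * (r - x) ^ p) (at x)" for x
      unfolding F_def
      by (rule derivative_eq_intros refl | simp del: power_Suc of_nat_Suc)+ (simp add: algebra_simps)
  qed (use assms in auto)
  also have "(\<lambda>x. ennreal (x * (r - x) ^ p) * indicator {0..r} x) = (\<lambda>x. ennreal x * trunc_power p r x)"
    by (auto simp: trunc_power_def ennreal_mult split: split_indicator)
  also have "F r - F 0 = r / real (p + 2) * (r ^ Suc p / real (Suc p))"
    by (simp add: F_def field_simps)
  finally show ?thesis .
qed

text \<open>Up to its mass this is the density of \<open>r\<close> times a Beta(1,
  \<open>p + 1\<close>) variable, whence the mean. Its maximum \<open>r ^ p\<close>, attained at 0,
  is \<open>Suc p / r\<close> times the mass.\<close>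

lemma profile_trunc_power:
  assumes "0 < r"
  shows "profile (trunc_power p r) r (r ^ Suc p / real (Suc p)) (r / real (p + 2)) {real (Suc p) / r}"
proof -
  have "trunc_power p r x \<le> ennreal (real (Suc p) / r * (r ^ Suc p / real (Suc p)))" for x
    using assms by (auto simp: trunc_power_def intro!: ennreal_leI power_mono split: split_indicator)
  moreover have "trunc_power p r \<in> borel_measurable borel"
    unfolding trunc_power_def by measurable
  ultimately show ?thesis
    using assms unfolding profile_def
    by (auto simp: nn_integral_trunc_power nn_integral_trunc_power_moment log_concave_trunc_power
        simp del: power_Suc of_nat_Suc) (auto simp: trunc_power_def)
qed

interpretation lborel_product: product_sigma_finite "\<lambda>_. lborel :: real measure" ..

text \<open>The integral is the iterated convolution of all \<open>f j\<close> with
  \<open>g\<close>: the entries in \<open>J\<close> are free and \<open>g\<close> receives what they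
  leave of \<open>s\<close>. An integral over one row of a matrix thus becomes a profile in one
  variable.\<close>

lemma profile_PiM:
  fixes f :: "'i \<Rightarrow> real \<Rightarrow> ennreal"
  assumes "finite J" "\<And>j. j \<in> J \<Longrightarrow> profile (f j) (R j) (i j) (m j) (B j)" and g: "profile g S l k C"
  shows "profile (\<lambda>s. \<integral>\<^sup>+x. (\<Prod>j\<in>J. f j (x j)) * g (s - (\<Sum>j\<in>J. x j)) \<partial>(\<Pi>\<^sub>M j\<in>J. lborel))
    ((\<Sum>j\<in>J. R j) + S) ((\<Prod>j\<in>J. i j) * l) ((\<Sum>j\<in>J. m j) + k) ((\<Union>j\<in>J. B j) \<union> C)"
  using assms(1,2)
proof (induction J)
  case empty
  then show ?case using g by (simp add: PiM_empty nn_integral_count_space_finite)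
next
  case (insert a J)
  have [measurable]: "\<And>j. j \<in> insert a J \<Longrightarrow> f j \<in> borel_measurable borel" "g \<in> borel_measurable borel"
    using insert.prems g by (auto simp: profile_def)
  let ?h = "\<lambda>s. \<integral>\<^sup>+x. (\<Prod>j\<in>J. f j (x j)) * g (s - (\<Sum>j\<in>J. x j)) \<partial>(\<Pi>\<^sub>M j\<in>J. lborel)"
  have "(\<integral>\<^sup>+x. (\<Prod>j\<in>insert a J. f j (x j)) * g (s - (\<Sum>j\<in>insert a J. x j)) \<partial>(\<Pi>\<^sub>M j\<in>insert a J. lborel))
      = convolution_fun (f a) ?h s" for s
  proof -
    have "(\<integral>\<^sup>+x. (\<Prod>j\<in>insert a J. f j (x j)) * g (s - (\<Sum>j\<in>insert a J. x j)) \<partial>(\<Pi>\<^sub>M j\<in>insert a J. lborel))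
      = (\<integral>\<^sup>+t. \<integral>\<^sup>+x. (\<Prod>j\<in>insert a J. f j ((x(a := t)) j)) * g (s - (\<Sum>j\<in>insert a J. (x(a := t)) j)) \<partial>(\<Pi>\<^sub>M j\<in>J. lborel) \<partial>lborel)"
      using insert by (intro lborel_product.product_nn_integral_insert_rev) measurable
    also have "\<dots> = (\<integral>\<^sup>+t. \<integral>\<^sup>+x. f a t * ((\<Prod>j\<in>J. f j (x j)) * g (s - t - (\<Sum>j\<in>J. x j))) \<partial>(\<Pi>\<^sub>M j\<in>J. lborel) \<partial>lborel)"
    proof (intro nn_integral_cong)
      fix t :: real and x :: "'i \<Rightarrow> real"
      have "(\<Prod>j\<in>J. f j ((x(a := t)) j)) = (\<Prod>j\<in>J. f j (x j))" "(\<Sum>j\<in>J. (x(a := t)) j) = (\<Sum>j\<in>J. x j)"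
        using insert.hyps by (auto intro!: prod.cong sum.cong)
      then show "(\<Prod>j\<in>insert a J. f j ((x(a := t)) j)) * g (s - (\<Sum>j\<in>insert a J. (x(a := t)) j))
        = f a t * ((\<Prod>j\<in>J. f j (x j)) * g (s - t - (\<Sum>j\<in>J. x j)))"
        using insert.hyps by (simp add: mult_ac diff_diff_eq)
    qed
    also have "\<dots> = convolution_fun (f a) ?h s"
      unfolding convolution_fun_def
      by (intro nn_integral_cong nn_integral_cmult) measurable
    finally show ?thesis .
  qed
  moreover have "profile (convolution_fun (f a) ?h) (R a + ((\<Sum>j\<in>J. R j) + S)) (i a * ((\<Prod>j\<in>J. i j) * l))
      (m a + ((\<Sum>j\<in>J. m j) + k)) (B a \<union> ((\<Union>j\<in>J. B j) \<union> C))"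
    using insert by (intro profile_convolution_fun) auto
  ultimately show ?case using insert.hyps by (simp add: add.assoc mult.assoc Un_assoc)
qed

section \<open>Volume of the Birkhoff polytope\<close>

text \<open>
  The first \<open>k\<close> rows and \<open>m\<close> columns of a nonnegative matrix with \<open>k + 1\<close> rows of sum 1 and \<open>m + 1\<close>
  columns, of which the first \<open>m\<close> have sums \<open>\<rho>\<close>. The last condition says that the corner entry of the
  completed matrix is nonnegative.
\<close>

definition substochastic :: "nat \<Rightarrow> nat \<Rightarrow> (nat \<Rightarrow> real) \<Rightarrow> (nat \<times> nat \<Rightarrow> real) \<Rightarrow> bool" where
  "substochastic m k \<rho> y \<longleftrightarrow>
     (\<forall>i\<in>{1..k}. \<forall>j\<in>{1..m}. 0 \<le> y (i, j)) \<and>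
     (\<forall>i\<in>{1..k}. (\<Sum>j\<in>{1..m}. y (i, j)) \<le> 1) \<and>
     (\<forall>j\<in>{1..m}. (\<Sum>i\<in>{1..k}. y (i, j)) \<le> \<rho> j) \<and>
     (\<Sum>j\<in>{1..m}. \<rho> j) \<le> 1 + (\<Sum>i\<in>{1..k}. \<Sum>j\<in>{1..m}. y (i, j))"

lemma measurable_substochastic [measurable]:
  "Measurable.pred (\<Pi>\<^sub>M ij\<in>{1..k} \<times> {1..m}. lborel) (substochastic m k \<rho>)"
  unfolding substochastic_def by measurable

text \<open>Passing from the reduced column sums to \<open>\<rho>\<close> adds the sum of
  \<open>x\<close> to both sides of the corner condition, so it carries over.\<close>

lemma substochastic_Suc:
  assumes x: "\<forall>j\<in>{1..m}. 0 \<le> x j" "(\<Sum>j\<in>{1..m}. x j) \<le> 1"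
    and y: "substochastic m k (\<lambda>j. \<rho> j - x j) y"
    and z: "\<And>i j. i \<in> {1..k} \<Longrightarrow> j \<in> {1..m} \<Longrightarrow> z (i, j) = y (i, j)" "\<And>j. j \<in> {1..m} \<Longrightarrow> z (Suc k, j) = x j"
  shows "substochastic m (Suc k) \<rho> z"
proof -
  have split: "{1..Suc k} = insert (Suc k) {1..k}" by auto
  have row: "(\<Sum>j\<in>{1..m}. z (i, j)) = (\<Sum>j\<in>{1..m}. y (i, j))" if "i \<in> {1..k}" for i
    using z that by (intro sum.cong) auto
  have col: "(\<Sum>i\<in>{1..k}. z (i, j)) = (\<Sum>i\<in>{1..k}. y (i, j))" if "j \<in> {1..m}" for j
    using z that by (intro sum.cong) auto
  have last: "(\<Sum>j\<in>{1..m}. z (Suc k, j)) = (\<Sum>j\<in>{1..m}. x j)"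
    using z by (intro sum.cong) auto
  have "(\<Sum>i\<in>{1..k}. \<Sum>j\<in>{1..m}. z (i, j)) = (\<Sum>i\<in>{1..k}. \<Sum>j\<in>{1..m}. y (i, j))"
    by (rule sum.cong) (use row in auto)
  then show ?thesis
    unfolding substochastic_def split
    using x y z by (auto simp: substochastic_def row col last sum_subtractf le_diff_eq add.commute simp del: One_nat_def)
qed

text \<open>Factor \<open>i\<close> is the loss on adding the \<open>i\<close>-th row: each of the
  \<open>Suc m\<close> columns contributes a division by \<open>i\<close> through the mass of its
  truncated power, and the rest is the loss in passing to the value at the mean.\<close>

definition vol_const :: "nat \<Rightarrow> nat \<Rightarrow> real" where
  "vol_const m k = (\<Prod>i\<in>{1..k}. 1 / (real i ^ Suc m * (256 * real (Suc m) ^ 5)))"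

text \<open>The truncated powers have means \<open>\<rho> j / (k + 2)\<close> and
  \<open>s / (k + 2)\<close>, and the column sums total \<open>k + 2\<close>. Hence the convolution
  has mean 1, which is the row sum at which it is evaluated, and \<open>profile_at_mean\<close>
  applies.\<close>

lemma volume_substochastic_step:
  assumes r: "\<And>j. j \<in> J \<Longrightarrow> 0 < \<rho> j" "finite J" and s: "0 < s" "(\<Sum>j\<in>J. \<rho> j) + s = real (k + 2)"
    and "k < card J"
  shows "(\<integral>\<^sup>+x. (\<Prod>j\<in>J. trunc_power k (\<rho> j) (x j)) * trunc_power k s (1 - (\<Sum>j\<in>J. x j)) \<partial>(\<Pi>\<^sub>M j\<in>J. lborel))
    \<ge> ennreal ((\<Prod>j\<in>J. \<rho> j ^ Suc k) * s ^ Suc k / (real (Suc k) ^ Suc (card J) * (256 * real (Suc (card J)) ^ 5)))"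
    (is "?f \<ge> _")
proof -
  define n where "n = real (Suc (card J))"
  let ?i = "(\<Prod>j\<in>J. \<rho> j ^ Suc k / real (Suc k)) * (s ^ Suc k / real (Suc k))"
  let ?B = "(\<Union>j\<in>J. {real (Suc k) / \<rho> j}) \<union> {real (Suc k) / s}"
  have mean: "(\<Sum>j\<in>J. \<rho> j / real (k + 2)) + s / real (k + 2) = 1"
    using s by (simp add: s(2) flip: sum_divide_distrib add_divide_distrib)
  have "profile (\<lambda>t. \<integral>\<^sup>+x. (\<Prod>j\<in>J. trunc_power k (\<rho> j) (x j)) * trunc_power k s (t - (\<Sum>j\<in>J. x j)) \<partial>(\<Pi>\<^sub>M j\<in>J. lborel))
    ((\<Sum>j\<in>J. \<rho> j) + s) ?i ((\<Sum>j\<in>J. \<rho> j / real (k + 2)) + s / real (k + 2)) ?B"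
    using r s by (intro profile_PiM profile_trunc_power) auto
  then have prof: "profile (\<lambda>t. \<integral>\<^sup>+x. (\<Prod>j\<in>J. trunc_power k (\<rho> j) (x j)) * trunc_power k s (t - (\<Sum>j\<in>J. x j)) \<partial>(\<Pi>\<^sub>M j\<in>J. lborel))
    (real (k + 2)) ?i 1 ?B"
    unfolding mean s(2) .
  \<comment> \<open>Pigeonhole: the total \<open>k + 2\<close> exceeds \<open>k + 1\<close>, so one
    of the \<open>n\<close> columns has mass at least \<open>(k + 1) / n\<close>, and its truncated
    power has a height bound of at most \<open>n\<close>.\<close>
  have "\<exists>b\<in>?B. 0 < b \<and> b \<le> n"
  proof (rule ccontr)
    assume "\<not> ?thesis"
    then have "n < b" if "b \<in> ?B" for b
      using that r s by (force simp: not_le)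
    then have "n < real (Suc k) / \<rho> j" if "j \<in> J" for j using that by auto
    then have *: "\<rho> j \<le> real (Suc k) / n" if "j \<in> J" for j
      using r(1)[OF that] that by (force simp: n_def field_simps intro: less_imp_le)
    have "n < real (Suc k) / s" using \<open>\<And>b. b \<in> ?B \<Longrightarrow> n < b\<close> by auto
    then have "s \<le> real (Suc k) / n" using s(1) by (simp add: n_def field_simps)
    moreover have "(\<Sum>j\<in>J. \<rho> j) \<le> real (card J) * (real (Suc k) / n)"
      using sum_bounded_above[of J \<rho> "real (Suc k) / n"] * by simp
    ultimately have "real (k + 2) \<le> real (card J) * (real (Suc k) / n) + real (Suc k) / n" using s(2) by linarith
    also have "\<dots> = (real (card J) + 1) * (real (Suc k) / n)" by (simp only: distrib_right mult_1_left)
    also have "\<dots> = n * (real (Suc k) / n)" by (simp only: n_def of_nat_Suc add.commute)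
    also have "\<dots> = real (Suc k)" by (simp add: n_def del: of_nat_Suc)
    finally show False by simp
  qed
  then obtain b where b: "b \<in> ?B" "0 < b" "b \<le> n" by blast
  have "0 < ?i" using r s by (intro mult_pos_pos prod_pos) auto
  then have at_mean: "?f \<ge> ennreal (?i / (256 * b ^ 3 * real (k + 2) ^ 2))"
    using b by (intro profile_at_mean[OF prof]) auto
  have le: "?i / (256 * n ^ 5) \<le> ?i / (256 * b ^ 3 * real (k + 2) ^ 2)"
  proof -
    \<comment> \<open>The support ends at \<open>k + 2\<close>, which is at most \<open>n\<close>
      because \<open>k < card J\<close>.\<close>
    have "b ^ 3 * real (k + 2) ^ 2 \<le> n ^ 3 * n ^ 2"
      using b \<open>k < card J\<close> by (intro mult_mono power_mono) (auto simp: n_def)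
    also have "n ^ 3 * n ^ 2 = n ^ 5" by (simp flip: power_add)
    finally show ?thesis using \<open>0 < ?i\<close> b by (intro divide_left_mono) auto
  qed
  have eq: "?i / (256 * n ^ 5) = (\<Prod>j\<in>J. \<rho> j ^ Suc k) * s ^ Suc k / (real (Suc k) ^ Suc (card J) * (256 * n ^ 5))"
    by (simp only: prod_dividef prod_constant times_divide_times_eq divide_divide_eq_left power_Suc2 mult.assoc)
  from order_trans[OF ennreal_leI[OF le] at_mean] show ?thesis
    unfolding eq by (simp only: n_def)
qed

text \<open>Induction on the number of free rows; the sum of the implicit last column enters on the
  same footing as the others. By Fubini the volume is an integral over the new row. Its fibres are
  bounded by the induction hypothesis for the reduced column sums, and the resulting integral is
  that of \<open>volume_substochastic_step\<close>. For \<open>k = 0\<close> only the determined row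
  remains and both sides are 1.\<close>

lemma volume_substochastic:
  assumes "k \<le> m" "\<And>j. j \<in> {1..m} \<Longrightarrow> 0 \<le> \<rho> j" "(\<Sum>j\<in>{1..m}. \<rho> j) \<le> real (Suc k)"
  shows "emeasure (\<Pi>\<^sub>M ij\<in>{1..k} \<times> {1..m}. lborel) {y \<in> space (\<Pi>\<^sub>M ij\<in>{1..k} \<times> {1..m}. lborel). substochastic m k \<rho> y}
    \<ge> ennreal (vol_const m k * ((\<Prod>j\<in>{1..m}. \<rho> j ^ k) * (real (Suc k) - (\<Sum>j\<in>{1..m}. \<rho> j)) ^ k))"
  using assms
proof (induction k arbitrary: \<rho>)
  case 0
  then show ?case
    by (simp add: PiM_empty vol_const_def substochastic_def)
next
  case (Suc k)
  define s where "s = real (Suc (Suc k)) - (\<Sum>j\<in>{1..m}. \<rho> j)"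
  let ?I = "{Suc k} \<times> {1..m}" and ?K = "{1..k} \<times> {1..m}"
  have IK: "{1..Suc k} \<times> {1..m} = ?I \<union> ?K" by auto
  show ?case
  \<comment> \<open>A column of mass 0 makes the bound 0, as the exponent \<open>Suc k\<close> is
    positive. The profiles of truncated powers require positive mass.\<close>
  proof (cases "s = 0 \<or> (\<exists>j\<in>{1..m}. \<rho> j = 0)")
    case True
    then have "(\<Prod>j\<in>{1..m}. \<rho> j ^ Suc k) * s ^ Suc k = 0" by auto
    then show ?thesis by (simp only: s_def[symmetric]) simp
  next
    case False
    have "0 < s" using False Suc.prems(3) by (auto simp: s_def)
    have pos: "0 < \<rho> j" if "j \<in> {1..m}" for j
      using False Suc.prems(2)[OF that] that by force
    have inj: "inj_on (Pair (Suc k)) {1..m}" by (auto intro: inj_onI)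
    have I_eq: "?I = Pair (Suc k) ` {1..m}" by auto
    have sum_I: "(\<Sum>ij\<in>?I. h ij) = (\<Sum>j\<in>{1..m}. h (Suc k, j))" for h :: "nat \<times> nat \<Rightarrow> real"
      unfolding I_eq by (subst sum.reindex[OF inj]) simp
    have prod_I: "(\<Prod>ij\<in>?I. h ij) = (\<Prod>j\<in>{1..m}. h (Suc k, j))" for h :: "nat \<times> nat \<Rightarrow> 'b::comm_monoid_mult"
      unfolding I_eq by (subst prod.reindex[OF inj]) simp
    let ?M = "\<lambda>K. \<Pi>\<^sub>M ij\<in>K. lborel :: real measure"
    have vc: "0 \<le> vol_const m k" unfolding vol_const_def by (intro prod_nonneg) auto
    \<comment> \<open>The fibre over a given new row \<open>x\<close>. The truncated powers express
      the induction hypothesis as a function of \<open>x\<close>; they vanish when \<open>x\<close>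
      is not admissible.\<close>
    have step: "ennreal (vol_const m k) * ((\<Prod>ij\<in>?I. trunc_power k (\<rho> (snd ij)) (x ij)) * trunc_power k s (1 - (\<Sum>ij\<in>?I. x ij)))
        \<le> (\<integral>\<^sup>+y. indicator {y. substochastic m (Suc k) \<rho> y} (merge ?I ?K (x, y)) \<partial>?M ?K)" for x :: "nat \<times> nat \<Rightarrow> real"
    proof (cases "(\<forall>j\<in>{1..m}. x (Suc k, j) \<in> {0..\<rho> j}) \<and> 1 - (\<Sum>j\<in>{1..m}. x (Suc k, j)) \<in> {0..s}")
      case False
      then have zero: "(\<Prod>j\<in>{1..m}. trunc_power k (\<rho> j) (x (Suc k, j))) * trunc_power k s (1 - (\<Sum>j\<in>{1..m}. x (Suc k, j))) = 0"
      proof (cases "\<forall>j\<in>{1..m}. x (Suc k, j) \<in> {0..\<rho> j}")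
        case False
        then obtain j where "j \<in> {1..m}" "x (Suc k, j) \<notin> {0..\<rho> j}" by blast
        then have "trunc_power k (\<rho> j) (x (Suc k, j)) = 0" by (simp add: trunc_power_def)
        then have "(\<Prod>j\<in>{1..m}. trunc_power k (\<rho> j) (x (Suc k, j))) = 0"
          using \<open>j \<in> {1..m}\<close> by (intro prod_zero) auto
        then show ?thesis by simp
      qed (auto simp: trunc_power_def)
      then show ?thesis unfolding sum_I prod_I snd_conv zero by simp
    next
      case True
      define \<sigma> where "\<sigma> j = \<rho> j - x (Suc k, j)" for j
      \<comment> \<open>The last column receives the rest of the new row; what it keeps is the last
        column sum belonging to \<open>\<sigma>\<close>.\<close>
      have sum_\<sigma>: "real (Suc k) - (\<Sum>j\<in>{1..m}. \<sigma> j) = s - (1 - (\<Sum>j\<in>{1..m}. x (Suc k, j)))"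
        by (simp add: \<sigma>_def s_def sum_subtractf)
      have "(\<Prod>j\<in>{1..m}. trunc_power k (\<rho> j) (x (Suc k, j))) = (\<Prod>j\<in>{1..m}. ennreal (\<sigma> j ^ k))"
        using True by (intro prod.cong) (auto simp: trunc_power_def \<sigma>_def)
      also have "\<dots> = ennreal (\<Prod>j\<in>{1..m}. \<sigma> j ^ k)"
        using True by (intro prod_ennreal) (auto simp: \<sigma>_def)
      finally have "ennreal (vol_const m k) * ((\<Prod>ij\<in>?I. trunc_power k (\<rho> (snd ij)) (x ij)) * trunc_power k s (1 - (\<Sum>ij\<in>?I. x ij)))
         = ennreal (vol_const m k) * (ennreal (\<Prod>j\<in>{1..m}. \<sigma> j ^ k) * ennreal ((real (Suc k) - (\<Sum>j\<in>{1..m}. \<sigma> j)) ^ k))"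
        using True unfolding sum_\<sigma> unfolding sum_I prod_I snd_conv by (simp add: trunc_power_def)
      also have "\<dots> = ennreal (vol_const m k * ((\<Prod>j\<in>{1..m}. \<sigma> j ^ k) * (real (Suc k) - (\<Sum>j\<in>{1..m}. \<sigma> j)) ^ k))"
      proof -
        have "0 \<le> (\<Prod>j\<in>{1..m}. \<sigma> j ^ k)" "0 \<le> (real (Suc k) - (\<Sum>j\<in>{1..m}. \<sigma> j)) ^ k"
          using True unfolding sum_\<sigma> by (auto intro!: prod_nonneg zero_le_power simp: \<sigma>_def)
        then show ?thesis using vc by (simp only: ennreal_mult mult_nonneg_nonneg)
      qed
      also have "\<dots> \<le> emeasure (?M ?K) {y \<in> space (?M ?K). substochastic m k \<sigma> y}"
        using Suc.prems True sum_\<sigma> by (intro Suc.IH) (auto simp: \<sigma>_def)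
      also have "\<dots> = (\<integral>\<^sup>+y. indicator {y \<in> space (?M ?K). substochastic m k \<sigma> y} y \<partial>?M ?K)"
        by (rule nn_integral_indicator[symmetric]) measurable
      also have "\<dots> \<le> (\<integral>\<^sup>+y. indicator {y. substochastic m (Suc k) \<rho> y} (merge ?I ?K (x, y)) \<partial>?M ?K)"
      proof (rule nn_integral_mono)
        fix y :: "nat \<times> nat \<Rightarrow> real"
        have "substochastic m (Suc k) \<rho> (merge ?I ?K (x, y))" if "substochastic m k \<sigma> y"
          by (rule substochastic_Suc[of m "\<lambda>j. x (Suc k, j)" k \<rho> y])
            (use True that in \<open>auto simp: merge_def \<sigma>_def[abs_def]\<close>)
        then show "indicator {y \<in> space (?M ?K). substochastic m k \<sigma> y} y
            \<le> (indicator {y. substochastic m (Suc k) \<rho> y} (merge ?I ?K (x, y)) :: ennreal)"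
          by (auto split: split_indicator)
      qed
      finally show ?thesis .
    qed
    have [measurable]: "Measurable.pred (?M (?I \<union> ?K)) (substochastic m (Suc k) \<rho>)"
      unfolding IK[symmetric] by measurable
    have "ennreal (vol_const m (Suc k) * ((\<Prod>j\<in>{1..m}. \<rho> j ^ Suc k) * s ^ Suc k))
      = ennreal (vol_const m k) * ennreal ((\<Prod>j\<in>{1..m}. \<rho> j ^ Suc k) * s ^ Suc k / (real (Suc k) ^ Suc m * (256 * real (Suc m) ^ 5)))"
      using vc by (simp add: vol_const_def mult_ac del: power_Suc of_nat_Suc flip: ennreal_mult')
    also have "\<dots> \<le> ennreal (vol_const m k) *
       (\<integral>\<^sup>+x. (\<Prod>ij\<in>?I. trunc_power k (\<rho> (snd ij)) (x ij)) * trunc_power k s (1 - (\<Sum>ij\<in>?I. x ij)) \<partial>?M ?I)"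
      using volume_substochastic_step[of ?I "\<lambda>ij. \<rho> (snd ij)" s k] pos \<open>0 < s\<close> Suc.prems(1)
      by (intro mult_left_mono) (auto simp: sum_I prod_I s_def card_cartesian_product simp del: power_Suc of_nat_Suc One_nat_def)
    also have "\<dots> = (\<integral>\<^sup>+x. ennreal (vol_const m k) * ((\<Prod>ij\<in>?I. trunc_power k (\<rho> (snd ij)) (x ij)) * trunc_power k s (1 - (\<Sum>ij\<in>?I. x ij))) \<partial>?M ?I)"
      by (rule nn_integral_cmult[symmetric]) (unfold trunc_power_def, measurable)
    also have "\<dots> \<le> (\<integral>\<^sup>+x. \<integral>\<^sup>+y. indicator {y. substochastic m (Suc k) \<rho> y} (merge ?I ?K (x, y)) \<partial>?M ?K \<partial>?M ?I)"
      by (intro nn_integral_mono step)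
    also have "\<dots> = (\<integral>\<^sup>+y. indicator {y. substochastic m (Suc k) \<rho> y} y \<partial>?M (?I \<union> ?K))"
    proof (rule lborel_product.product_nn_integral_fold[symmetric])
      show "indicator {y. substochastic m (Suc k) \<rho> y} \<in> borel_measurable (?M (?I \<union> ?K))"
        by measurable
    qed auto
    also have "\<dots> = (\<integral>\<^sup>+y. indicator {y \<in> space (?M (?I \<union> ?K)). substochastic m (Suc k) \<rho> y} y \<partial>?M (?I \<union> ?K))"
      by (intro nn_integral_cong) (auto split: split_indicator)
    also have "\<dots> = emeasure (?M (?I \<union> ?K)) {y \<in> space (?M (?I \<union> ?K)). substochastic m (Suc k) \<rho> y}"
      by (rule nn_integral_indicator) measurable
    finally show ?thesis unfolding IK[symmetric] s_def .
  qed
qed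

section \<open>The block set and its symmetries\<close>

text \<open>The block determines the last row and column. Nonnegativity of their entries is the
  bound 1 on the sums of the block, except for the corner entry, which is the total of the block
  minus \<open>m - 1\<close>.\<close>

lemma upper_left_block_birkhoff_polytope:
  "upper_left_block (Suc m) ` birkhoff_polytope (Suc m) =
    {y \<in> space (block_lebesgue (Suc m)). substochastic m m (\<lambda>_. 1) y}"
proof (intro equalityI subsetI)
  have rows: "{1..Suc m} = insert (Suc m) {1..m}" by auto
  fix y assume "y \<in> upper_left_block (Suc m) ` birkhoff_polytope (Suc m)"
  then obtain x where x: "x \<in> birkhoff_polytope (Suc m)" and y: "y = restrict x ({1..m} \<times> {1..m})"
    by (auto simp: upper_left_block_def)
  have nonneg: "0 \<le> x (i, j)" if "i \<in> {1..Suc m}" "j \<in> {1..Suc m}" for i j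
    using x that by (auto simp: birkhoff_polytope_def PiE_iff)
  have row: "(\<Sum>j\<in>{1..m}. x (i, j)) = 1 - x (i, Suc m)" if "i \<in> {1..Suc m}" for i
  proof -
    have "(\<Sum>j\<in>{1..Suc m}. x (i, j)) = 1" using x that by (auto simp: birkhoff_polytope_def)
    then show ?thesis by (simp add: rows del: One_nat_def)
  qed
  have col: "(\<Sum>i\<in>{1..m}. x (i, j)) = 1 - x (Suc m, j)" if "j \<in> {1..Suc m}" for j
  proof -
    have "(\<Sum>i\<in>{1..Suc m}. x (i, j)) = 1" using x that by (auto simp: birkhoff_polytope_def)
    then show ?thesis by (simp add: rows del: One_nat_def)
  qed
  have y_row: "(\<Sum>j\<in>{1..m}. y (i, j)) = 1 - x (i, Suc m)" if "i \<in> {1..m}" for i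
    using row[of i] that by (simp add: y del: One_nat_def)
  have y_col: "(\<Sum>i\<in>{1..m}. y (i, j)) = 1 - x (Suc m, j)" if "j \<in> {1..m}" for j
    using col[of j] that by (simp add: y del: One_nat_def)
  have "(\<Sum>i\<in>{1..m}. \<Sum>j\<in>{1..m}. y (i, j)) = (\<Sum>i\<in>{1..m}. 1 - x (i, Suc m))"
    by (rule sum.cong) (use y_row in auto)
  also have "\<dots> = real m - (1 - x (Suc m, Suc m))"
    using col[of "Suc m"] by (simp add: sum_subtractf del: One_nat_def)
  finally have "(\<Sum>j\<in>{1..m}. 1) \<le> 1 + (\<Sum>i\<in>{1..m}. \<Sum>j\<in>{1..m}. y (i, j))"
    using nonneg[of "Suc m" "Suc m"] by simp
  then have "substochastic m m (\<lambda>_. 1) y"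
    unfolding substochastic_def
    using nonneg by (auto simp: y_row y_col simp del: One_nat_def) (auto simp: y)
  then show "y \<in> {y \<in> space (block_lebesgue (Suc m)). substochastic m m (\<lambda>_. 1) y}"
    by (simp add: y block_lebesgue_def space_PiM)
next
  have rows: "{1..Suc m} = insert (Suc m) {1..m}" by auto
  fix y assume "y \<in> {y \<in> space (block_lebesgue (Suc m)). substochastic m m (\<lambda>_. 1) y}"
  then have y: "y \<in> extensional ({1..m} \<times> {1..m})" "substochastic m m (\<lambda>_. 1) y"
    by (auto simp: block_lebesgue_def space_PiM PiE_iff)
  \<comment> \<open>The corner is chosen to make the last row sum to 1; exchanging the sums, as in
    \<open>total\<close>, shows that the last column does too.\<close>
  define x :: "nat \<times> nat \<Rightarrow> real" where "x = restrict (\<lambda>(i, j).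
      if i \<le> m then if j \<le> m then y (i, j) else 1 - (\<Sum>j\<in>{1..m}. y (i, j))
      else if j \<le> m then 1 - (\<Sum>i\<in>{1..m}. y (i, j))
      else 1 - (\<Sum>j\<in>{1..m}. 1 - (\<Sum>i\<in>{1..m}. y (i, j)))) ({1..Suc m} \<times> {1..Suc m})"
  have x_in: "x (i, j) = y (i, j)" if "i \<in> {1..m}" "j \<in> {1..m}" for i j
    using that by (simp add: x_def)
  have x_row: "x (i, Suc m) = 1 - (\<Sum>j\<in>{1..m}. y (i, j))" if "i \<in> {1..m}" for i
    using that by (simp add: x_def)
  have x_col: "x (Suc m, j) = 1 - (\<Sum>i\<in>{1..m}. y (i, j))" if "j \<in> {1..m}" for j
    using that by (simp add: x_def)
  have x_last: "x (Suc m, Suc m) = 1 - (\<Sum>j\<in>{1..m}. 1 - (\<Sum>i\<in>{1..m}. y (i, j)))"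
    by (simp add: x_def)
  have total: "(\<Sum>j\<in>{1..m}. 1 - (\<Sum>i\<in>{1..m}. y (i, j))) = (\<Sum>i\<in>{1..m}. 1 - (\<Sum>j\<in>{1..m}. y (i, j)))"
    using sum.swap[of "\<lambda>i j. y (i, j)" "{1..m}" "{1..m}"] by (simp add: sum_subtractf)
  have last_nonneg: "0 \<le> x (Suc m, Suc m)"
    using y(2) unfolding x_last total by (simp add: substochastic_def sum_subtractf)
  have "x \<in> {1..Suc m} \<times> {1..Suc m} \<rightarrow>\<^sub>E {0..}"
  proof (rule PiE_I)
    fix ij assume "ij \<in> {1..Suc m} \<times> {1..Suc m}"
    then obtain i j where ij: "ij = (i, j)" "i \<in> insert (Suc m) {1..m}" "j \<in> insert (Suc m) {1..m}"
      unfolding rows by auto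
    then show "x ij \<in> {0..}"
      using y(2) last_nonneg by (auto simp: x_in x_row x_col substochastic_def simp del: One_nat_def)
  qed (auto simp: x_def)
  moreover have "(\<Sum>j\<in>{1..Suc m}. x (i, j)) = 1" if "i \<in> {1..Suc m}" for i
  proof (cases "i = Suc m")
    case True
    have "(\<Sum>j\<in>{1..m}. x (Suc m, j)) = (\<Sum>j\<in>{1..m}. 1 - (\<Sum>i\<in>{1..m}. y (i, j)))"
      by (rule sum.cong) (use x_col in auto)
    then show ?thesis using True x_last by (simp add: rows del: One_nat_def)
  next
    case False
    then have i: "i \<in> {1..m}" using that by auto
    have "(\<Sum>j\<in>{1..m}. x (i, j)) = (\<Sum>j\<in>{1..m}. y (i, j))"
      by (rule sum.cong) (use x_in i in auto)
    then show ?thesis using x_row[OF i] by (simp add: rows del: One_nat_def)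
  qed
  moreover have "(\<Sum>i\<in>{1..Suc m}. x (i, j)) = 1" if "j \<in> {1..Suc m}" for j
  proof (cases "j = Suc m")
    case True
    have "(\<Sum>i\<in>{1..m}. x (i, Suc m)) = (\<Sum>i\<in>{1..m}. 1 - (\<Sum>j\<in>{1..m}. y (i, j)))"
      by (rule sum.cong) (use x_row in auto)
    then show ?thesis using True x_last total by (simp add: rows del: One_nat_def)
  next
    case False
    then have j: "j \<in> {1..m}" using that by auto
    have "(\<Sum>i\<in>{1..m}. x (i, j)) = (\<Sum>i\<in>{1..m}. y (i, j))"
      by (rule sum.cong) (use x_in j in auto)
    then show ?thesis using x_col[OF j] by (simp add: rows del: One_nat_def)
  qed
  ultimately have "x \<in> birkhoff_polytope (Suc m)" by (simp add: birkhoff_polytope_def)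
  moreover have "upper_left_block (Suc m) x = y"
  proof
    fix ij
    show "upper_left_block (Suc m) x ij = y ij"
      using y(1) by (cases ij) (auto simp: upper_left_block_def restrict_def x_in extensional_def simp del: One_nat_def)
  qed
  ultimately show "y \<in> upper_left_block (Suc m) ` birkhoff_polytope (Suc m)" by blast
qed

section \<open>Exchangeability of the entries\<close>

text \<open>Comparing boxes suffices, and the preimage of a box is the box with its sides permuted
  by the inverse \<open>u\<close> of \<open>t\<close>.\<close>

lemma (in product_sigma_finite) distr_PiM_permute:
  assumes "finite K" "bij_betw t K K" "\<And>k. k \<in> K \<Longrightarrow> M (t k) = M k"
  shows "distr (PiM K M) (PiM K M) (\<lambda>\<omega>. \<lambda>k\<in>K. \<omega> (t k)) = PiM K M"
proof (rule PiM_eqI)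
  have tK: "t k \<in> K" if "k \<in> K" for k using assms(2) that by (auto simp: bij_betw_def)
  have [measurable]: "(\<lambda>\<omega>. \<lambda>k\<in>K. \<omega> (t k)) \<in> PiM K M \<rightarrow>\<^sub>M PiM K M"
  proof (rule measurable_restrict)
    fix k assume "k \<in> K"
    then show "(\<lambda>\<omega>. \<omega> (t k)) \<in> PiM K M \<rightarrow>\<^sub>M M k"
      using measurable_component_singleton[OF tK, of k M] assms(3) by simp
  qed
  fix A assume A: "\<And>i. i \<in> K \<Longrightarrow> A i \<in> sets (M i)"
  define u where "u = the_inv_into K t"
  have u: "u (t k) = k" if "k \<in> K" for k
    using assms(2) that by (simp add: u_def bij_betw_def the_inv_into_f_f)
  have uK: "u k \<in> K" "t (u k) = k" if "k \<in> K" for k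
    using assms(2) that by (auto simp: u_def bij_betw_def f_the_inv_into_f the_inv_into_into)
  have Au: "A (u k) \<in> sets (M k)" if "k \<in> K" for k
    using A[of "u k"] assms(3)[of "u k"] uK[OF that] by simp
  have "(\<lambda>\<omega>. \<lambda>k\<in>K. \<omega> (t k)) -` Pi\<^sub>E K A \<inter> space (PiM K M) = Pi\<^sub>E K (\<lambda>k. A (u k))"
  proof (intro equalityI subsetI)
    fix \<omega> assume "\<omega> \<in> (\<lambda>\<omega>. \<lambda>k\<in>K. \<omega> (t k)) -` Pi\<^sub>E K A \<inter> space (PiM K M)"
    then have \<omega>: "\<omega> \<in> extensional K" "\<And>k. k \<in> K \<Longrightarrow> \<omega> (t k) \<in> A k"
      by (auto simp: space_PiM PiE_iff)
    have "\<omega> k \<in> A (u k)" if "k \<in> K" for k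
      using \<omega>(2)[OF uK(1)[OF that]] uK(2)[OF that] by simp
    then show "\<omega> \<in> Pi\<^sub>E K (\<lambda>k. A (u k))" using \<omega>(1) by (simp add: PiE_iff)
  next
    fix \<omega> assume \<omega>: "\<omega> \<in> Pi\<^sub>E K (\<lambda>k. A (u k))"
    have "\<omega> (t k) \<in> A k" if "k \<in> K" for k
      using PiE_mem[OF \<omega> tK[OF that]] u[OF that] by simp
    moreover have "\<omega> k \<in> space (M k)" if "k \<in> K" for k
      using PiE_mem[OF \<omega> that] Au[OF that, THEN sets.sets_into_space] by blast
    ultimately show "\<omega> \<in> (\<lambda>\<omega>. \<lambda>k\<in>K. \<omega> (t k)) -` Pi\<^sub>E K A \<inter> space (PiM K M)"
      using \<omega> by (simp add: space_PiM PiE_iff)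
  qed
  then have "emeasure (distr (PiM K M) (PiM K M) (\<lambda>\<omega>. \<lambda>k\<in>K. \<omega> (t k))) (Pi\<^sub>E K A)
      = emeasure (PiM K M) (Pi\<^sub>E K (\<lambda>k. A (u k)))"
    using A assms(1) by (subst emeasure_distr) (auto intro!: sets_PiM_I_finite)
  also have "\<dots> = (\<Prod>k\<in>K. emeasure (M k) (A (u k)))"
    using Au assms(1) by (intro emeasure_PiM) auto
  also have "\<dots> = (\<Prod>k\<in>K. emeasure (M (t k)) (A (u (t k))))"
    by (rule prod.reindex_bij_betw[OF assms(2), symmetric])
  also have "\<dots> = (\<Prod>k\<in>K. emeasure (M k) (A k))"
    using u assms(3) by simp
  finally show "emeasure (distr (PiM K M) (PiM K M) (\<lambda>\<omega>. \<lambda>k\<in>K. \<omega> (t k))) (Pi\<^sub>E K A) = (\<Prod>k\<in>K. emeasure (M k) (A k))" .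
qed (use assms in auto)

definition substochastic_blocks :: "nat \<Rightarrow> (nat \<times> nat \<Rightarrow> real) set" where
  "substochastic_blocks m = {y \<in> space (block_lebesgue (Suc m)). substochastic m m (\<lambda>_. 1) y}"

lemma sets_substochastic_blocks [measurable]:
  "substochastic_blocks m \<in> sets (block_lebesgue (Suc m))"
  unfolding substochastic_blocks_def block_lebesgue_def diff_Suc_1 by measurable

text \<open>All column sums are 1, the last one included, so the powers in
  \<open>volume_substochastic\<close> are 1.\<close>

lemma emeasure_substochastic_blocks_ge:
  "emeasure (block_lebesgue (Suc m)) (substochastic_blocks m) \<ge> ennreal (vol_const m m)"
  using volume_substochastic[of m m "\<lambda>_. 1"]
  by (simp add: substochastic_blocks_def block_lebesgue_def)

text \<open>Exchanging rows 1 and \<open>a\<close> and columns 1 and \<open>b\<close> preserves both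
  Lebesgue measure and the block set. The probability for one entry can therefore be read off from
  the mean count over all entries.\<close>

lemma emeasure_substochastic_blocks_entry:
  assumes ab: "a \<in> {1..m}" "b \<in> {1..m}" and A[measurable]: "A \<in> sets borel"
  shows "emeasure (block_lebesgue (Suc m)) (substochastic_blocks m \<inter> {y \<in> space (block_lebesgue (Suc m)). y (a, b) \<in> A})
    = emeasure (block_lebesgue (Suc m)) (substochastic_blocks m \<inter> {y \<in> space (block_lebesgue (Suc m)). y (1, 1) \<in> A})"
proof -
  define \<sigma> where "\<sigma> = Transposition.transpose 1 a"
  define \<tau> where "\<tau> = Transposition.transpose 1 b"
  let ?K = "{1..m} \<times> {1..m}"
  let ?L = "block_lebesgue (Suc m)"
  define T :: "(nat \<times> nat \<Rightarrow> real) \<Rightarrow> nat \<times> nat \<Rightarrow> real" where "T y = (\<lambda>k\<in>?K. y (map_prod \<sigma> \<tau> k))" for y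
  have bij: "bij_betw \<sigma> {1..m} {1..m}" "bij_betw \<tau> {1..m} {1..m}"
    using ab unfolding \<sigma>_def \<tau>_def bij_betw_transpose_iff by auto
  have mem: "\<sigma> i \<in> {1..m}" "\<tau> i \<in> {1..m}" if "i \<in> {1..m}" for i
    using bij that by (auto simp: bij_betw_def)
  have bijK: "bij_betw (map_prod \<sigma> \<tau>) ?K ?K"
    using bij by (rule bij_betw_map_prod)
  have L: "?L = (\<Pi>\<^sub>M ij\<in>?K. lborel)" by (simp add: block_lebesgue_def)
  have distr: "distr ?L ?L T = ?L"
    unfolding L T_def[abs_def] by (rule lborel_product.distr_PiM_permute[OF _ bijK]) auto
  have [measurable]: "T \<in> ?L \<rightarrow>\<^sub>M ?L"
    unfolding L T_def[abs_def]
    by (intro measurable_restrict measurable_component_singleton) (use mem in auto)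
  have entry: "T y (i, j) = y (\<sigma> i, \<tau> j)" if "i \<in> {1..m}" "j \<in> {1..m}" for y i j
    using that by (simp add: T_def del: One_nat_def)
  have row: "(\<Sum>j\<in>{1..m}. T y (i, j)) = (\<Sum>j\<in>{1..m}. y (\<sigma> i, j))" if "i \<in> {1..m}" for y i
  proof -
    have "(\<Sum>j\<in>{1..m}. T y (i, j)) = (\<Sum>j\<in>{1..m}. y (\<sigma> i, \<tau> j))"
      by (rule sum.cong) (use entry that in auto)
    then show ?thesis using sum.reindex_bij_betw[OF bij(2), of "\<lambda>j. y (\<sigma> i, j)"] by simp
  qed
  have col: "(\<Sum>i\<in>{1..m}. T y (i, j)) = (\<Sum>i\<in>{1..m}. y (i, \<tau> j))" if "j \<in> {1..m}" for y j
  proof -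
    have "(\<Sum>i\<in>{1..m}. T y (i, j)) = (\<Sum>i\<in>{1..m}. y (\<sigma> i, \<tau> j))"
      by (rule sum.cong) (use entry that in auto)
    then show ?thesis using sum.reindex_bij_betw[OF bij(1), of "\<lambda>i. y (i, \<tau> j)"] by simp
  qed
  have total: "(\<Sum>i\<in>{1..m}. \<Sum>j\<in>{1..m}. T y (i, j)) = (\<Sum>i\<in>{1..m}. \<Sum>j\<in>{1..m}. y (i, j))" for y
  proof -
    have "(\<Sum>i\<in>{1..m}. \<Sum>j\<in>{1..m}. T y (i, j)) = (\<Sum>i\<in>{1..m}. \<Sum>j\<in>{1..m}. y (\<sigma> i, j))"
      by (rule sum.cong) (use row in auto)
    then show ?thesis using sum.reindex_bij_betw[OF bij(1), of "\<lambda>i. \<Sum>j\<in>{1..m}. y (i, j)"] by simp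
  qed
  have image: "\<sigma> ` {1..m} = {1..m}" "\<tau> ` {1..m} = {1..m}" using bij by (auto simp: bij_betw_def)
  have ball_\<sigma>: "(\<forall>i\<in>{1..m}. P (\<sigma> i)) = (\<forall>i\<in>{1..m}. P i)" for P
  proof -
    have "(\<forall>i\<in>\<sigma> ` {1..m}. P i) = (\<forall>i\<in>{1..m}. P (\<sigma> i))" by blast
    then show ?thesis by (simp only: image)
  qed
  have ball_\<tau>: "(\<forall>i\<in>{1..m}. P (\<tau> i)) = (\<forall>i\<in>{1..m}. P i)" for P
  proof -
    have "(\<forall>i\<in>\<tau> ` {1..m}. P i) = (\<forall>i\<in>{1..m}. P (\<tau> i))" by blast
    then show ?thesis by (simp only: image)
  qed
  have inv: "substochastic m m (\<lambda>_. 1) (T y) = substochastic m m (\<lambda>_. 1) y" for y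
  proof -
    have "(\<forall>i\<in>{1..m}. \<forall>j\<in>{1..m}. 0 \<le> T y (i, j)) = (\<forall>i\<in>{1..m}. \<forall>j\<in>{1..m}. 0 \<le> y (\<sigma> i, \<tau> j))"
      by (simp add: entry del: One_nat_def)
    also have "\<dots> = (\<forall>i\<in>{1..m}. \<forall>j\<in>{1..m}. 0 \<le> y (i, \<tau> j))"
      by (rule ball_\<sigma>)
    also have "\<dots> = (\<forall>i\<in>{1..m}. \<forall>j\<in>{1..m}. 0 \<le> y (i, j))"
      by (intro ball_cong refl ball_\<tau>)
    finally have 1: "(\<forall>i\<in>{1..m}. \<forall>j\<in>{1..m}. 0 \<le> T y (i, j)) = (\<forall>i\<in>{1..m}. \<forall>j\<in>{1..m}. 0 \<le> y (i, j))" .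
    have 2: "(\<forall>i\<in>{1..m}. (\<Sum>j\<in>{1..m}. T y (i, j)) \<le> 1) = (\<forall>i\<in>{1..m}. (\<Sum>j\<in>{1..m}. y (i, j)) \<le> 1)"
      using ball_\<sigma>[of "\<lambda>i. (\<Sum>j\<in>{1..m}. y (i, j)) \<le> 1"] by (simp add: row del: One_nat_def)
    have 3: "(\<forall>j\<in>{1..m}. (\<Sum>i\<in>{1..m}. T y (i, j)) \<le> 1) = (\<forall>j\<in>{1..m}. (\<Sum>i\<in>{1..m}. y (i, j)) \<le> 1)"
      using ball_\<tau>[of "\<lambda>j. (\<Sum>i\<in>{1..m}. y (i, j)) \<le> 1"] by (simp add: col del: One_nat_def)
    show ?thesis unfolding substochastic_def 1 2 3 total ..
  qed
  have TyS: "T y \<in> space ?L" for y by (simp add: L T_def space_PiM)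
  let ?S = "substochastic_blocks m \<inter> {y \<in> space ?L. y (1, 1) \<in> A}"
  have [measurable]: "(\<lambda>y. y (1, 1)) \<in> ?L \<rightarrow>\<^sub>M borel"
    unfolding L using measurable_component_singleton[of "(1, 1)" ?K "\<lambda>_. lborel :: real measure"] ab by simp
  have "emeasure ?L ?S = emeasure (distr ?L ?L T) ?S" by (simp only: distr)
  also have "\<dots> = emeasure ?L (T -` ?S \<inter> space ?L)"
    by (rule emeasure_distr) measurable
  also have "T -` ?S \<inter> space ?L = substochastic_blocks m \<inter> {y \<in> space ?L. y (a, b) \<in> A}"
    using ab entry[of 1 1] by (auto simp: substochastic_blocks_def inv TyS \<sigma>_def \<tau>_def simp del: One_nat_def)
  finally show ?thesis ..
qed

section \<open>Exponential tilting\<close>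

text \<open>The left-hand side is the moment generating function at \<open>\<theta>\<close> of a
  Bernoulli variable of mean \<open>q\<close>.\<close>

lemma exp_tilt_bound:
  assumes "0 \<le> \<theta>" "\<theta> \<le> 1" "0 \<le> q" "q \<le> (1::real)"
  shows "1 + (exp \<theta> - 1) * q \<le> exp (q * \<theta> + \<theta>\<^sup>2)"
proof -
  have "exp \<theta> \<le> 1 + \<theta> + \<theta>\<^sup>2" using assms by (intro exp_bound) auto
  then have "(exp \<theta> - 1) * q \<le> (\<theta> + \<theta>\<^sup>2) * q" using assms by (intro mult_right_mono) auto
  moreover have "\<theta>\<^sup>2 * q \<le> \<theta>\<^sup>2" using assms by (intro mult_left_le) auto
  ultimately have "1 + (exp \<theta> - 1) * q \<le> 1 + (q * \<theta> + \<theta>\<^sup>2)" by (simp add: algebra_simps)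
  also have "\<dots> \<le> exp (q * \<theta> + \<theta>\<^sup>2)" by simp
  finally show ?thesis .
qed

text \<open>Substituting \<open>s = c * t\<close> removes the scale; under the exponential law
  \<open>indicator A\<close> is then a Bernoulli variable of mean \<open>q\<close>.\<close>

lemma nn_integral_tilted_exponential:
  assumes A[measurable]: "A \<in> sets borel" and \<theta>: "0 \<le> \<theta>" "\<theta> \<le> 1" and "0 < c"
  defines "q \<equiv> measure (density lborel (exponential_density 1)) A"
  shows "(\<integral>\<^sup>+t. ennreal (c * exponential_density 1 (c * t) * exp (\<theta> * indicator A (c * t))) \<partial>lborel)
    \<le> ennreal (exp (q * \<theta> + \<theta>\<^sup>2))"
proof -
  interpret E: prob_space "density lborel (exponential_density 1)"
    by (rule prob_space_exponential_density) simp
  have aux: "ennreal (exp \<theta>) = 1 + ennreal (exp \<theta> - 1)"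
    using \<theta> ennreal_plus[of 1 "exp \<theta> - 1"] by simp
  let ?W = "\<lambda>s. ennreal (exponential_density 1 s * exp (\<theta> * indicator A s))"
  have "(\<integral>\<^sup>+t. ennreal (c * exponential_density 1 (c * t) * exp (\<theta> * indicator A (c * t))) \<partial>lborel)
      = (\<integral>\<^sup>+t. ennreal c * ?W (0 + c * t) \<partial>lborel)"
    using \<open>0 < c\<close> by (simp add: ennreal_mult' mult.assoc)
  also have "\<dots> = (\<integral>\<^sup>+s. ?W s \<partial>lborel)"
    using nn_integral_real_affine[of ?W c 0] \<open>0 < c\<close> by (simp add: nn_integral_cmult)
  also have "\<dots> = (\<integral>\<^sup>+s. ennreal (exp (\<theta> * indicator A s)) \<partial>density lborel (exponential_density 1))"
    by (subst nn_integral_density) (auto simp: ennreal_mult' exponential_density_nonneg)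
  also have "\<dots> = (\<integral>\<^sup>+s. 1 + ennreal (exp \<theta> - 1) * indicator A s \<partial>density lborel (exponential_density 1))"
    by (intro nn_integral_cong) (auto simp: aux split: split_indicator)
  also have "\<dots> = 1 + ennreal (exp \<theta> - 1) * emeasure (density lborel (exponential_density 1)) A"
    using E.emeasure_space_1 by (simp add: nn_integral_add nn_integral_cmult)
  also have "\<dots> = ennreal (1 + (exp \<theta> - 1) * q)"
    using \<theta> by (simp add: q_def E.emeasure_eq_measure ennreal_mult)
  also have "\<dots> \<le> ennreal (exp (q * \<theta> + \<theta>\<^sup>2))"
    using \<theta> by (intro ennreal_leI exp_tilt_bound) (auto simp: q_def)
  finally show ?thesis .
qed

text \<open>Jensen's inequality, from the tangent to \<open>exp\<close> at the mean of
  \<open>N\<close>.\<close>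

lemma (in prob_space) exp_expectation_le_nn_integral:
  assumes [measurable]: "N \<in> borel_measurable M" and "\<And>x. \<bar>N x\<bar> \<le> (b::real)"
  shows "ennreal (exp (expectation N)) \<le> (\<integral>\<^sup>+x. ennreal (exp (N x)) \<partial>M)"
proof -
  let ?c = "expectation N"
  have N: "integrable M N" using assms(2) by (intro integrable_const_bound[of _ b]) auto
  have e: "integrable M (\<lambda>x. exp (N x))"
  proof (rule integrable_const_bound[of _ "exp b"])
    show "AE x in M. norm (exp (N x)) \<le> exp b"
      using assms(2) by (auto intro: order_trans[OF abs_ge_self])
  qed measurable
  have "exp ?c = expectation (\<lambda>x. exp ?c * (1 + (N x - ?c)))"
    using N prob_space by (simp add: Bochner_Integration.integral_add Bochner_Integration.integral_diff)
  also have "\<dots> \<le> expectation (\<lambda>x. exp (N x))"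
  proof (rule integral_mono[OF _ e])
    show "integrable M (\<lambda>x. exp ?c * (1 + (N x - ?c)))" using N by simp
    fix x
    have "exp ?c * (1 + (N x - ?c)) \<le> exp ?c * exp (N x - ?c)"
      by (intro mult_left_mono exp_ge_add_one_self) auto
    then show "exp ?c * (1 + (N x - ?c)) \<le> exp (N x)" by (simp flip: exp_add)
  qed
  finally have "ennreal (exp ?c) \<le> ennreal (expectation (\<lambda>x. exp (N x)))" by (rule ennreal_leI)
  then show ?thesis using nn_integral_eq_integral[OF e] by simp
qed

text \<open>The product over all entries of tilted exponential densities of rate
  \<open>Suc m\<close> is integrated. Over the whole space the integral factorises and is at most
  the right-hand side. Over the block set alone, the pointwise bound \<open>ge\<close> and Jensen's
  inequality, with mean count \<open>m * m * p\<close>, give at least the left-hand side.\<close>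

lemma substochastic_blocks_tilting:
  fixes m :: nat and A :: "real set"
  assumes "0 < m" and A[measurable]: "A \<in> sets borel" and \<theta>: "0 \<le> \<theta>" "\<theta> \<le> 1"
    and V: "emeasure (block_lebesgue (Suc m)) (substochastic_blocks m) = ennreal V" "0 < V"
  defines "p \<equiv> measure (uniform_measure (block_lebesgue (Suc m)) (substochastic_blocks m))
      {y \<in> space (block_lebesgue (Suc m)). real (Suc m) * y (1, 1) \<in> A}"
    and "q \<equiv> measure (density lborel (exponential_density 1)) A"
  shows "V * (real (Suc m) ^ (m * m) * exp (- real (Suc m) * real m)) * exp (\<theta> * (real (m * m) * p))
    \<le> exp (real (m * m) * (q * \<theta> + \<theta>\<^sup>2))"
proof -
  define c where "c = real (Suc m)"
  have "0 < c" by (simp add: c_def)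
  let ?K = "{1..m} \<times> {1..m}" and ?L = "block_lebesgue (Suc m)" and ?B = "substochastic_blocks m"
  define U where "U = uniform_measure ?L ?B"
  interpret U: prob_space U
    unfolding U_def using V by (intro prob_space_uniform_measure) auto
  have L: "?L = (\<Pi>\<^sub>M ij\<in>?K. lborel)" by (simp add: block_lebesgue_def)
  have sets_U: "sets U = sets ?L" by (simp add: U_def)
  have comp[measurable]: "(\<lambda>y. y k) \<in> ?L \<rightarrow>\<^sub>M borel" if "k \<in> ?K" for k
    unfolding L using measurable_component_singleton[of k ?K "\<lambda>_. lborel :: real measure"] that by simp
  have compU[measurable]: "(\<lambda>y. y k) \<in> U \<rightarrow>\<^sub>M borel" if "k \<in> ?K" for k
    using comp[OF that] by (simp add: U_def)
  \<comment> \<open>The number of entries whose rescaled value lies in \<open>A\<close>; the tilt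
    multiplies the product density by \<open>exp (\<theta> * N y)\<close>.\<close>
  define N :: "(nat \<times> nat \<Rightarrow> real) \<Rightarrow> real" where "N y = (\<Sum>k\<in>?K. indicator A (c * y k))" for y
  have N_U[measurable]: "N \<in> borel_measurable U"
    unfolding N_def by (intro borel_measurable_sum) measurable
  have N_L[measurable]: "N \<in> borel_measurable ?L"
    using N_U by (simp add: U_def)
  have EN: "U.expectation N = real (m * m) * p"
  proof -
    have one: "U.expectation (\<lambda>y. indicator A (c * y k)) = p" if k: "k \<in> ?K" for k
    proof -
      obtain a b where ab: "k = (a, b)" "a \<in> {1..m}" "b \<in> {1..m}" using k by auto
      have [measurable]: "{t. c * t \<in> A} \<in> sets borel"
        by measurable
      let ?S = "\<lambda>k. {y \<in> space ?L. c * y k \<in> A}"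
      have S: "?S k \<in> sets ?L" "?S (1, 1) \<in> sets ?L"
        using k \<open>0 < m\<close> by (auto intro!: measurable_sets_Collect)
      have "U.expectation (\<lambda>y. indicator A (c * y k)) = U.expectation (indicator (?S k))"
        by (intro Bochner_Integration.integral_cong) (auto simp: U_def split: split_indicator)
      also have "\<dots> = measure U (?S k)"
        using S by (simp add: sets_U)
      also have "\<dots> = measure U (?S (1, 1))"
      proof -
        have "emeasure ?L (?B \<inter> ?S k) = emeasure ?L (?B \<inter> ?S (1, 1))"
          using emeasure_substochastic_blocks_entry[OF ab(2,3), of "{t. c * t \<in> A}"] ab(1) by simp
        then show ?thesis
          unfolding U_def measure_def
          by (simp only: emeasure_uniform_measure sets_substochastic_blocks S)
      qed
      finally show ?thesis by (simp add: p_def U_def c_def)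
    qed
    have int: "integrable U (\<lambda>y. indicator A (c * y k) :: real)" if "k \<in> ?K" for k
      using that by (intro U.integrable_const_bound[of _ 1]) (auto split: split_indicator)
    have "U.expectation N = (\<Sum>k\<in>?K. U.expectation (\<lambda>y. indicator A (c * y k)))"
      unfolding N_def by (intro Bochner_Integration.integral_sum int)
    also have "\<dots> = (\<Sum>k\<in>?K. p)" by (intro sum.cong refl one)
    finally show ?thesis by (simp add: card_cartesian_product)
  qed
  have N_bound: "\<bar>\<theta> * N y\<bar> \<le> real (card ?K)" for y
  proof -
    have "N y \<le> real (card ?K)"
      unfolding N_def using sum_bounded_above[of ?K "\<lambda>k. indicator A (c * y k)" "1::real"]
      by (simp split: split_indicator)
    moreover have "0 \<le> N y" unfolding N_def by (intro sum_nonneg) auto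
    ultimately show ?thesis using \<theta> by (auto simp: abs_mult intro: order_trans[OF mult_left_le_one_le])
  qed
  define w where "w t = ennreal (c * exponential_density 1 (c * t) * exp (\<theta> * indicator A (c * t)))" for t
  have [measurable]: "w \<in> borel_measurable borel" unfolding w_def by measurable
  define D where "D = c ^ (m * m) * exp (- c * real m)"
  have "0 < D" using \<open>0 < c\<close> by (simp add: D_def)
  \<comment> \<open>For nonnegative entries the untilted product density depends only on their sum,
    which is at most \<open>m\<close> on the block set.\<close>
  have ge: "ennreal D * ennreal (exp (\<theta> * N y)) * indicator ?B y \<le> (\<Prod>k\<in>?K. w (y k))" for y
  proof (cases "y \<in> ?B")
    case True
    then have y: "substochastic m m (\<lambda>_. 1) y" by (simp add: substochastic_blocks_def)
    have "(\<Sum>k\<in>?K. y k) = (\<Sum>i\<in>{1..m}. \<Sum>j\<in>{1..m}. y (i, j))"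
      by (simp add: sum.cartesian_product)
    also have "\<dots> \<le> (\<Sum>i\<in>{1..m}. 1)"
      using y by (intro sum_mono) (auto simp: substochastic_def)
    finally have total: "(\<Sum>k\<in>?K. y k) \<le> real m" by simp
    have "w (y k) = ennreal (c * exp (- c * y k) * exp (\<theta> * indicator A (c * y k)))" if "k \<in> ?K" for k
    proof -
      have "0 \<le> y k" using y that by (auto simp: substochastic_def)
      then have "0 \<le> c * y k" using \<open>0 < c\<close> by simp
      then show ?thesis by (simp add: w_def exponential_density_def)
    qed
    then have "(\<Prod>k\<in>?K. w (y k)) = (\<Prod>k\<in>?K. ennreal (c * exp (- c * y k) * exp (\<theta> * indicator A (c * y k))))"
      by (intro prod.cong) auto
    also have "\<dots> = ennreal (\<Prod>k\<in>?K. c * exp (- c * y k) * exp (\<theta> * indicator A (c * y k)))"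
      using \<open>0 < c\<close> by (intro prod_ennreal) auto
    also have "(\<Prod>k\<in>?K. c * exp (- c * y k) * exp (\<theta> * indicator A (c * y k)))
        = c ^ (m * m) * exp (- c * (\<Sum>k\<in>?K. y k)) * exp (\<theta> * N y)"
    proof -
      have "finite ?K" "card ?K = m * m" by (simp_all add: card_cartesian_product)
      then show ?thesis
        by (simp only: prod.distrib prod_constant N_def sum_distrib_left exp_sum)
    qed
    also have "ennreal \<dots> \<ge> ennreal (c ^ (m * m) * exp (- c * real m) * exp (\<theta> * N y))"
      using \<open>0 < c\<close> total by (intro ennreal_leI mult_right_mono mult_left_mono) auto
    finally show ?thesis using True \<open>0 < D\<close> by (simp add: D_def ennreal_mult)
  qed simp
  have "ennreal (exp (\<theta> * (real (m * m) * p))) = ennreal (exp (U.expectation (\<lambda>y. \<theta> * N y)))"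
    by (simp add: EN)
  also have "\<dots> \<le> (\<integral>\<^sup>+y. ennreal (exp (\<theta> * N y)) \<partial>U)"
    using N_bound by (intro U.exp_expectation_le_nn_integral) auto
  also have "\<dots> = (\<integral>\<^sup>+y. ennreal (exp (\<theta> * N y)) * indicator ?B y \<partial>?L) / ennreal V"
    unfolding U_def V(1)[symmetric] by (intro nn_integral_uniform_measure) auto
  finally have "ennreal V * ennreal (exp (\<theta> * (real (m * m) * p)))
      \<le> ennreal V * ((\<integral>\<^sup>+y. ennreal (exp (\<theta> * N y)) * indicator ?B y \<partial>?L) / ennreal V)"
    by (intro mult_left_mono) auto
  also have "\<dots> = (\<integral>\<^sup>+y. ennreal (exp (\<theta> * N y)) * indicator ?B y \<partial>?L)"
    using V(2) by (subst ennreal_times_divide, subst mult.commute, intro ennreal_mult_divide_eq) auto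
  finally have "ennreal D * (ennreal V * ennreal (exp (\<theta> * (real (m * m) * p))))
      \<le> ennreal D * (\<integral>\<^sup>+y. ennreal (exp (\<theta> * N y)) * indicator ?B y \<partial>?L)"
    by (intro mult_left_mono) auto
  also have "\<dots> = (\<integral>\<^sup>+y. ennreal D * ennreal (exp (\<theta> * N y)) * indicator ?B y \<partial>?L)"
    unfolding mult.assoc by (rule nn_integral_cmult[symmetric]) measurable
  also have "\<dots> \<le> (\<integral>\<^sup>+y. (\<Prod>k\<in>?K. w (y k)) \<partial>?L)"
    by (intro nn_integral_mono ge)
  also have "\<dots> = (\<Prod>k\<in>?K. \<integral>\<^sup>+t. w t \<partial>lborel)"
    unfolding L by (rule lborel_product.product_nn_integral_prod) auto
  also have "\<dots> = (\<integral>\<^sup>+t. w t \<partial>lborel) ^ (m * m)"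
    by (simp add: card_cartesian_product)
  also have "\<dots> \<le> ennreal (exp (q * \<theta> + \<theta>\<^sup>2)) ^ (m * m)"
    unfolding w_def q_def using \<theta> \<open>0 < c\<close> by (intro power_mono nn_integral_tilted_exponential) auto
  also have "\<dots> = ennreal (exp (real (m * m) * (q * \<theta> + \<theta>\<^sup>2)))"
    by (simp only: ennreal_power exp_ge_zero exp_of_nat_mult)
  finally have "ennreal (D * (V * exp (\<theta> * (real (m * m) * p)))) \<le> ennreal (exp (real (m * m) * (q * \<theta> + \<theta>\<^sup>2)))"
    using \<open>0 < D\<close> V(2) by (simp add: ennreal_mult)
  then have "D * (V * exp (\<theta> * (real (m * m) * p))) \<le> exp (real (m * m) * (q * \<theta> + \<theta>\<^sup>2))"
    by (subst (asm) ennreal_le_iff) auto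
  then show ?thesis by (simp add: D_def c_def mult_ac)
qed

section \<open>Total variation distance\<close>

text \<open>A weak form of Stirling's bound. The induction step is \<open>ln x \<le> x - 1\<close>
  at \<open>x = m / (m + 1)\<close>.\<close>

lemma ln_fact_le:
  assumes "0 < m"
  shows "ln (fact m) \<le> (real m + 1) * ln (real m) - real m + 1"
  using assms
proof (induction m rule: nat_induct_non_zero)
  case (Suc m)
  have "1 - real m / real (Suc m) \<le> - ln (real m / real (Suc m))"
    using ln_le_minus_one[of "real m / real (Suc m)"] Suc by simp
  then have "1 / real (Suc m) \<le> ln (real (Suc m)) - ln (real m)"
    using Suc.hyps by (simp add: ln_div field_simps)
  then have "1 \<le> real (Suc m) * (ln (real (Suc m)) - ln (real m))"
    by (simp add: divide_le_eq mult.commute)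
  moreover have "ln (fact (Suc m)) = ln (real (Suc m)) + ln (fact m :: real)"
    by (simp add: ln_mult)
  ultimately show ?case using Suc.IH by (simp add: algebra_simps)
qed simp

lemma vol_const_eq: "vol_const m m = 1 / (fact m ^ Suc m * (256 * real (Suc m) ^ 5) ^ m)"
proof -
  have "(\<Prod>i\<in>{1..m}. 1 / (real i ^ l * D)) = 1 / (fact m ^ l * D ^ m)" for l and D :: real
    by (simp add: prod_dividef prod.distrib prod_power_distrib fact_prod)
  then show ?thesis unfolding vol_const_def .
qed

text \<open>The main terms are the logarithm of \<open>exp (n * m) / n ^ (m * m)\<close> and cancel
  the explicit factor in \<open>substochastic_blocks_tilting\<close>. The 18 counts multiples of
  \<open>m * ln n\<close>: 8 from \<open>ln 256\<close>, 5 from \<open>n ^ 5\<close>, 3 from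
  \<open>n * n - m * m = 2 * m + 1\<close> and 2 from the summand \<open>n\<close>.\<close>

lemma ln_vol_const_ge:
  assumes "2 \<le> m"
  defines "n \<equiv> real (Suc m)"
  shows "ln (vol_const m m) \<ge> n * m - real (m * m) * ln n - 18 * real m * ln n"
proof -
  have n: "n = real m + 1" "3 \<le> n" using assms by (auto simp: n_def)
  have "exp 1 \<le> (3::real)" by (rule exp_le)
  then have ln1: "1 \<le> ln n" using n by (subst ln_ge_iff) auto
  have "ln (real m) \<le> ln n" using assms by (simp add: n_def)
  then have "(real m + 1) * ln (real m) \<le> n * ln n" using ln1 n by (intro mult_mono) auto
  then have "ln (fact m) \<le> n * ln n - m + 1" using ln_fact_le[of m] assms by linarith
  then have "n * ln (fact m) \<le> n * (n * ln n - m + 1)" using n by (intro mult_left_mono) auto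
  moreover have "ln (256::real) \<le> 8"
  proof -
    have "ln (256::real) = ln (2 ^ 8)" by simp
    also have "\<dots> = 8 * ln 2" by (subst ln_realpow) auto
    also have "\<dots> \<le> 8" using ln_le_minus_one[of "2::real"] by simp
    finally show ?thesis .
  qed
  then have "m * (ln 256 + 5 * ln n) \<le> m * (8 + 5 * ln n)" by (intro mult_left_mono) auto
  moreover have "- ln (vol_const m m) = n * ln (fact m) + m * (ln 256 + 5 * ln n)"
    using n by (simp add: vol_const_eq ln_div ln_mult ln_realpow n_def[symmetric] del: of_nat_Suc power_Suc) (simp add: n_def distrib_left)
  moreover have "n * (n * ln n - m + 1) = n * n * ln n - n * m + n" by (simp add: algebra_simps)
  moreover have "n * n * ln n = real (m * m) * ln n + 2 * (m * ln n) + ln n" by (simp add: n algebra_simps)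
  moreover have "n \<le> 2 * (m * ln n)" "8 * real m \<le> 8 * (m * ln n)" "ln n \<le> m * ln n"
  proof -
    have "real m * 1 \<le> m * ln n" using ln1 by (intro mult_left_mono) auto
    then show "n \<le> 2 * (m * ln n)" "8 * real m \<le> 8 * (m * ln n)" using n(1) assms(1) by linarith+
    have "1 * ln n \<le> m * ln n" using ln1 assms by (intro mult_right_mono) auto
    then show "ln n \<le> m * ln n" by simp
  qed
  ultimately show ?thesis by (simp add: algebra_simps)
qed

section \<open>From the tilted inequality to total variation\<close>

text \<open>After taking logarithms, tilting and the volume bound give
  \<open>\<theta> * (p - q) \<le> \<theta>\<^sup>2 + 18 * ln n / m\<close>. The choice
  \<open>\<theta> = sqrt (ln n / n)\<close> balances the two terms, and \<open>m \<ge> n / 2\<close>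
  turns 18 into 36, hence 37 in total.\<close>

lemma uniform_doubly_stochastic_one_sided:
  assumes X: "uniform_doubly_stochastic n M X" and n: "3 \<le> n" and A[measurable]: "A \<in> sets borel"
  shows "measure (distr M borel (\<lambda>\<omega>. real n * X \<omega> (1, 1))) A
      - measure (density lborel (exponential_density 1)) A \<le> 37 * sqrt (ln n / n)"
proof -
  define m where "m = n - 1"
  have nm: "n = Suc m" "2 \<le> m" using n by (auto simp: m_def)
  let ?L = "block_lebesgue (Suc m)" and ?B = "substochastic_blocks m"
  let ?Y = "\<lambda>\<omega>. upper_left_block (Suc m) (X \<omega>)"
  interpret M: prob_space M using X by (simp add: uniform_doubly_stochastic_def)
  have Xm[measurable]: "X \<in> M \<rightarrow>\<^sub>M (\<Pi>\<^sub>M ij\<in>{1..n} \<times> {1..n}. borel)"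
    and distr: "distr M ?L ?Y = uniform_measure ?L ?B"
    using X by (auto simp: uniform_doubly_stochastic_def upper_left_block_birkhoff_polytope substochastic_blocks_def nm(1))
  have X_entry[measurable]: "(\<lambda>\<omega>. X \<omega> k) \<in> M \<rightarrow>\<^sub>M borel" if "k \<in> {1..n} \<times> {1..n}" for k
    by (rule measurable_compose[OF Xm]) (rule measurable_component_singleton[OF that])
  have Ym[measurable]: "?Y \<in> M \<rightarrow>\<^sub>M ?L"
    unfolding upper_left_block_def block_lebesgue_def diff_Suc_1
    using X_entry by (intro measurable_restrict) (auto simp: nm(1))
  interpret U: prob_space "uniform_measure ?L ?B"
    unfolding distr[symmetric] by (rule M.prob_space_distr) measurable
  \<comment> \<open>The uniform measure is a probability measure by hypothesis. In
    \<open>ennreal\<close> both 0 / 0 and top / top are 0, so the volume is positive and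
    finite.\<close>
  have "emeasure ?L ?B \<noteq> 0 \<and> emeasure ?L ?B \<noteq> \<infinity>"
  proof -
    have "emeasure (uniform_measure ?L ?B) (space ?L) = emeasure ?L (?B \<inter> space ?L) / emeasure ?L ?B"
      by (rule emeasure_uniform_measure) auto
    then have "emeasure ?L (?B \<inter> space ?L) / emeasure ?L ?B = 1"
      using U.emeasure_space_1 by simp
    moreover have "?B \<inter> space ?L = ?B" by (auto simp: substochastic_blocks_def)
    ultimately show ?thesis by auto
  qed
  then obtain V where V: "emeasure ?L ?B = ennreal V" "0 < V"
    by (cases "emeasure ?L ?B") (auto simp: ennreal_zero_less_mult_iff)
  have "0 < vol_const m m" by (simp add: vol_const_eq)
  have "vol_const m m \<le> V"
    using emeasure_substochastic_blocks_ge[of m] V by (simp add: ennreal_le_iff)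
  then have lnV: "ln (vol_const m m) \<le> ln V" using \<open>0 < vol_const m m\<close> by simp
  define p where "p = measure (distr M borel (\<lambda>\<omega>. real n * X \<omega> (1, 1))) A"
  define q where "q = measure (density lborel (exponential_density 1)) A"
  have entry: "(\<lambda>y. y (1, 1)) \<in> ?L \<rightarrow>\<^sub>M borel"
    unfolding block_lebesgue_def
    using measurable_component_singleton[of "(1, 1)" "{1..m} \<times> {1..m}" "\<lambda>_. lborel :: real measure"] nm by simp
  have S: "{y \<in> space ?L. real (Suc m) * y (1, 1) \<in> A} \<in> sets ?L"
    using entry by measurable
  have p: "p = measure (uniform_measure ?L ?B) {y \<in> space ?L. real (Suc m) * y (1, 1) \<in> A}"
  proof -
    have 11: "(1, 1) \<in> {1..n} \<times> {1..n}" using n by auto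
    have "p = measure M ((\<lambda>\<omega>. real n * X \<omega> (1, 1)) -` A \<inter> space M)"
      unfolding p_def using X_entry[OF 11] by (intro measure_distr) auto
    also have "(\<lambda>\<omega>. real n * X \<omega> (1, 1)) -` A \<inter> space M
        = ?Y -` {y \<in> space ?L. real (Suc m) * y (1, 1) \<in> A} \<inter> space M"
      using nm measurable_space[OF Ym] by (auto simp: upper_left_block_def)
    also have "measure M \<dots> = measure (distr M ?L ?Y) {y \<in> space ?L. real (Suc m) * y (1, 1) \<in> A}"
      using S by (intro measure_distr[symmetric]) auto
    finally show ?thesis by (simp only: distr)
  qed
  define r where "r = real n"
  define \<theta> where "\<theta> = sqrt (ln r / r)"
  have r: "3 \<le> r" "r = real m + 1" using n by (auto simp: r_def nm)
  have "exp 1 \<le> (3::real)" by (rule exp_le)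
  then have ln1: "1 \<le> ln r" using r by (subst ln_ge_iff) auto
  have "ln r \<le> r" using r ln_le_minus_one[of r] by linarith
  then have \<theta>: "0 < \<theta>" "\<theta> \<le> 1" using r ln1 by (auto simp: \<theta>_def)
  have "V * (r ^ (m * m) * exp (- r * real m)) * exp (\<theta> * (real (m * m) * p))
      \<le> exp (real (m * m) * (q * \<theta> + \<theta>\<^sup>2))"
    using substochastic_blocks_tilting[of m A \<theta> V] V \<theta> nm by (simp add: p q_def r_def)
  then have "ln (V * (r ^ (m * m) * exp (- r * real m)) * exp (\<theta> * (real (m * m) * p)))
      \<le> ln (exp (real (m * m) * (q * \<theta> + \<theta>\<^sup>2)))"
    using V r by (subst ln_le_cancel_iff) auto
  also have "\<dots> = real (m * m) * (q * \<theta> + \<theta>\<^sup>2)" by (rule ln_exp)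
  finally have "ln (V * (r ^ (m * m) * exp (- r * real m)) * exp (\<theta> * (real (m * m) * p)))
      \<le> real (m * m) * (q * \<theta> + \<theta>\<^sup>2)" .
  moreover have "ln (V * (r ^ (m * m) * exp (- r * real m)) * exp (\<theta> * (real (m * m) * p)))
      = ln V + (real (m * m) * ln r - r * m) + \<theta> * (real (m * m) * p)"
    using V r by (simp add: ln_mult ln_realpow algebra_simps)
  moreover have "ln V \<ge> r * m - real (m * m) * ln r - 18 * real m * ln r"
    using ln_vol_const_ge[OF nm(2)] lnV by (simp add: r_def nm)
  ultimately have "\<theta> * (real (m * m) * p) \<le> real (m * m) * (q * \<theta> + \<theta>\<^sup>2) + 18 * real m * ln r"
    by linarith
  then have "m * (m * (\<theta> * (p - q))) \<le> m * (m * \<theta>\<^sup>2 + 18 * ln r)"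
    by (simp add: algebra_simps)
  then have "m * (\<theta> * (p - q)) \<le> m * \<theta>\<^sup>2 + 18 * ln r"
    using nm by (simp only: mult_le_cancel_left_pos of_nat_0_less_iff)
  also have "18 * ln r \<le> m * (36 * \<theta>\<^sup>2)"
  proof -
    have "\<theta>\<^sup>2 = ln r / r" using r ln1 by (simp add: \<theta>_def)
    moreover have "r / 2 \<le> m" using r nm by simp
    then have "r / 2 * (36 * (ln r / r)) \<le> m * (36 * (ln r / r))" using r ln1 by (intro mult_right_mono) auto
    ultimately show ?thesis using r by simp
  qed
  finally have "m * (\<theta> * (p - q)) \<le> m * (\<theta> * (37 * \<theta>))"
    by (simp add: algebra_simps power2_eq_square)
  then have "p - q \<le> 37 * \<theta>"
    using \<theta> nm by (simp add: mult_le_cancel_left_pos)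
  then show ?thesis by (simp add: p_def q_def \<theta>_def r_def)
qed

text \<open>Passing to the complement of \<open>A\<close> reverses the sign of the difference, so
  the one-sided bound gives both sides.\<close>

lemma uniform_doubly_stochastic_tv_dist:
  assumes X: "uniform_doubly_stochastic n M X" and n: "3 \<le> n"
  shows "\<bar>tv_dist (distr M borel (\<lambda>\<omega>. real n * X \<omega> (1, 1))) (density lborel (exponential_density 1))\<bar>
    \<le> 37 * sqrt (ln n / n)"
proof -
  let ?P = "distr M borel (\<lambda>\<omega>. real n * X \<omega> (1, 1))" and ?Q = "density lborel (exponential_density 1)"
  interpret M: prob_space M using X by (simp add: uniform_doubly_stochastic_def)
  have "(\<lambda>\<omega>. X \<omega> (1, 1)) \<in> M \<rightarrow>\<^sub>M borel"
    using X n measurable_component_singleton[of "(1, 1)" "{1..n} \<times> {1..n}" "\<lambda>_. borel :: real measure"]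
    unfolding uniform_doubly_stochastic_def by (auto intro: measurable_compose)
  then interpret P: prob_space ?P by (intro M.prob_space_distr) measurable
  interpret Q: prob_space ?Q by (rule prob_space_exponential_density) simp
  have le: "\<bar>measure ?P A - measure ?Q A\<bar> \<le> 37 * sqrt (ln n / n)" if "A \<in> sets ?P" for A
  proof -
    have A: "A \<in> sets borel" "UNIV - A \<in> sets borel" using that by auto
    have "measure ?P (UNIV - A) = 1 - measure ?P A" using P.prob_compl[of A] A by simp
    moreover have "measure ?Q (UNIV - A) = 1 - measure ?Q A" using Q.prob_compl[of A] A by simp
    ultimately show ?thesis
      using uniform_doubly_stochastic_one_sided[OF X n A(1)] uniform_doubly_stochastic_one_sided[OF X n A(2)]
      by (simp add: abs_le_iff)
  qed
  have bdd: "bdd_above ((\<lambda>A. \<bar>measure ?P A - measure ?Q A\<bar>) ` sets ?P)"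
    using le by (intro bdd_aboveI2) auto
  have "0 \<le> tv_dist ?P ?Q"
    unfolding tv_dist_def using cSUP_upper[OF _ bdd, of "{}"] by simp
  moreover have "tv_dist ?P ?Q \<le> 37 * sqrt (ln n / n)"
    unfolding tv_dist_def using sets.empty_sets[of ?P] by (intro cSUP_least le) auto
  ultimately show ?thesis by simp
qed

theorem theorem1:
  fixes M :: "nat \<Rightarrow> 'a measure" and X :: "nat \<Rightarrow> 'a \<Rightarrow> nat \<times> nat \<Rightarrow> real"
    and d :: "nat \<Rightarrow> real"
  assumes "\<And>n. n \<ge> 1 \<Longrightarrow> uniform_doubly_stochastic n (M n) (X n)"
  defines "d \<equiv> (\<lambda>n. tv_dist (distr (M n) borel (\<lambda>\<omega>. real n * X n \<omega> (1, 1)))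
                             (density lborel (exponential_density 1)))"
  shows "d \<longlonglongrightarrow> 0 \<and> (\<forall>\<epsilon>>0. d \<in> O(\<lambda>n. real n powr (- 1 / 2 + \<epsilon>)))"
proof (intro conjI allI impI)
  have le: "\<forall>\<^sub>F n in sequentially. norm (d n) \<le> 37 * sqrt (ln n / n)"
    using eventually_ge_at_top[of 3]
  proof eventually_elim
    case (elim n)
    then show ?case
      unfolding d_def using uniform_doubly_stochastic_tv_dist[OF assms(1)[of n]] by simp
  qed
  have "(\<lambda>n::nat. 37 * sqrt (ln n / n)) \<longlonglongrightarrow> 0" by real_asymp
  then show "d \<longlonglongrightarrow> 0" by (rule Lim_null_comparison[OF le])
  fix \<epsilon> :: real
  assume "0 < \<epsilon>"
  have "d \<in> O(\<lambda>n. 37 * sqrt (ln n / n))"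
    using le by (intro bigoI[of _ 1]) (auto elim: eventually_mono)
  \<comment> \<open>\<open>sqrt (ln n)\<close> grows more slowly than any positive power of
    \<open>n\<close>.\<close>
  also have "(\<lambda>n::nat. 37 * sqrt (ln n / n)) \<in> O(\<lambda>n. real n powr (- 1 / 2 + \<epsilon>))"
    using \<open>0 < \<epsilon>\<close> by real_asymp
  finally show "d \<in> O(\<lambda>n. real n powr (- 1 / 2 + \<epsilon>))" .
qed

end
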